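(* Let $n\ge 1$, $\lambda_1,\dots,\lambda_n>0$, let $\Gamma$ be a cocompact lattice of the oscillator group $\mathrm{Osc}_n(\lambda_1,\dots,\lambda_n)$, and consider the compact Lorentzian manifold $M=\mathrm{Osc}_n(\lambda_1,\dots,\lambda_n)/\Gamma$. Then exactly one of the following situations occurs: (1) either $\Gamma$ contains an element of the form $(0,0,t_0)$ for some $t_0\in\mathbb{R}$, $t_0\neq 0$, and in this situation every lightlike geodesic of $M$ is closed; (2) or, for every $t\neq 0$, one has $(0,0,t)\notin\Gamma$. In this case, at every point of $M$ there is exactly one direction (one-dimensional lightlike subspace of the tangent space) for which all lightlike geodesics of $M$ with initial velocity in that direction are closed, and every lightlike geodesic with initial velocity in any other direction is non-closed. This direction is the one spanned by (the left-invariant vector field induced by) the lightlike element $Z\in\mathfrak{osc}_n(\lambda_1,\dots,\lambda_n)$.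
   Context: For $\lambda_1,\dots,\lambda_n>0$, the oscillator group $\mathrm{Osc}_n(\lambda_1,\dots,\lambda_n)$ is the manifold $\mathbb{R}\times\mathbb{R}^{2n}\times\mathbb{R}$ with elements $(z,v,t)$ and product $$(z_1,v_1,t_1)(z_2,v_2,t_2)=\bigl(z_1+z_2+\tfrac12 v_1^{\tau}JR(t_1)v_2,\; v_1+R(t_1)v_2,\; t_1+t_2\bigr),$$ where $v^{\tau}$ is the transpose, $R(t)=e^{tN_\lambda}$, $N_\lambda=\mathrm{diag}(J_{\lambda_1},\dots,J_{\lambda_n})$ is block diagonal with blocks $J_{\mu}=\begin{pmatrix}0&-\mu\\ \mu&0\end{pmatrix}$, and $J=N_{(-1,\dots,-1)}$ is block diagonal with blocks $J_{-1}$. It is the simply connected Lie group with Lie algebra $\mathfrak{osc}_n(\lambda_1,\dots,\lambda_n)$, which has basis $Z,X_1,Y_1,\dots,X_n,Y_n,T$ and non-trivial brackets $[X_i,Y_i]=Z$, $[T,X_i]=\lambda_iY_i$, $[T,Y_i]=-\lambda_iX_i$. The basis corresponds to the coordinate directions at the identity: $Z$ to $z$, $X_i,Y_i$ to the coordinates $x_i,y_i$ of $v=(x_1,y_1,\dots,x_n,y_n)$, and $T$ to $t$. The group carries the bi-invariant Lorentzian metric obtained by left translation of the ad-invariant form whose only non-zero relations are $\lambda_i\langle X_i,X_i\rangle=\lambda_i\langle Y_i,Y_i\rangle=\langle Z,T\rangle=1$. A (cocompact) lattice is a discrete subgroup $\Gamma$ with compact quotient. The quotient $G/\Gamma$ (cosets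 $g\Gamma$) carries the unique Lorentzian metric making the projection $\pi:G\to G/\Gamma$ a local isometry; left translations $\tau_g(h\Gamma)=gh\Gamma$ are isometries of $G/\Gamma$. A geodesic is lightlike if its velocity $X$ satisfies $\langle X,X\rangle=0$. A geodesic is closed if it is periodic. *)

theory Defs
  imports "HOL-Analysis.Analysis" "HOL-Algebra.Left_Coset"
begin

section \<open>Pseudo-Riemannian metrics in a global chart and their geodesics\<close>

text \<open>A metric on a manifold with a single global chart is a family of bilinear forms
  \<open>g p\<close> on the model space. The Christoffel map \<open>christoffel g p u v\<close> is the value at \<open>p\<close> of the
  Levi-Civita derivative of the coordinate field \<open>v\<close> in direction \<open>u\<close>; it is determined by the
  Koszul formula, whose bracket terms vanish for coordinate fields.\<close>

definition christoffel ::
    "('a::real_normed_vector \<Rightarrow> 'a \<Rightarrow> 'a \<Rightarrow> real) \<Rightarrow> 'a \<Rightarrow> 'a \<Rightarrow> 'a \<Rightarrow> 'a" where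
  "christoffel g p u v = (THE w. \<forall>x. g p w x =
     (frechet_derivative (\<lambda>q. g q v x) (at p) u
      + frechet_derivative (\<lambda>q. g q u x) (at p) v
      - frechet_derivative (\<lambda>q. g q u v) (at p) x) / 2)"

definition geodesic_on ::
    "('a::real_normed_vector \<Rightarrow> 'a \<Rightarrow> 'a \<Rightarrow> real) \<Rightarrow> real set \<Rightarrow> (real \<Rightarrow> 'a) \<Rightarrow> bool" where
  "geodesic_on g I \<gamma> \<longleftrightarrow> (\<exists>\<gamma>' \<gamma>''. \<forall>s\<in>I.
     (\<gamma> has_vector_derivative \<gamma>' s) (at s) \<and>
     (\<gamma>' has_vector_derivative \<gamma>'' s) (at s) \<and>
     \<gamma>'' s + christoffel g (\<gamma> s) (\<gamma>' s) (\<gamma>' s) = 0)"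


section \<open>The oscillator group\<close>

text \<open>The factor $\mathbb{R}^{2n}$ is indexed by pairs: the coordinates \<open>x\<^sub>i\<close>, \<open>y\<^sub>i\<close> of \<open>v\<close> are
  \<open>v $ (i, 1)\<close> and \<open>v $ (i, 2)\<close>.\<close>

type_synonym 'n osc = "real \<times> (real ^ ('n \<times> 2)) \<times> real"

text \<open>Multiplication in the type class \<open>times\<close> (hence also \<open>^\<close>) is componentwise on
  \<open>vec\<close>, so powers of matrices are iterated \<open>**\<close>.\<close>

definition matrix_exp :: "real ^ 'm ^ 'm \<Rightarrow> real ^ 'm ^ ('m::finite)" where
  "matrix_exp A = (\<Sum>k. (1 / fact k) *\<^sub>R (((**) A ^^ k) (mat 1)))"

definition J_block :: "real \<Rightarrow> real ^ 2 ^ 2" where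
  "J_block \<mu> = vector [vector [0, - \<mu>], vector [\<mu>, 0]]"

definition N_mat :: "('n::finite \<Rightarrow> real) \<Rightarrow> real ^ ('n \<times> 2) ^ ('n \<times> 2)" where
  "N_mat lam =
     (\<chi> p q. if fst p = fst q then J_block (lam (fst p)) $ snd p $ snd q else 0)"

definition J_mat :: "real ^ ('n \<times> 2) ^ (('n::finite) \<times> 2)" where
  "J_mat = N_mat (\<lambda>_. -1)"

definition R_mat :: "('n::finite \<Rightarrow> real) \<Rightarrow> real \<Rightarrow> real ^ ('n \<times> 2) ^ ('n \<times> 2)" where
  "R_mat lam t = matrix_exp (t *\<^sub>R N_mat lam)"

fun osc_mult :: "('n::finite \<Rightarrow> real) \<Rightarrow> 'n osc \<Rightarrow> 'n osc \<Rightarrow> 'n osc" where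
  "osc_mult lam (z1, v1, t1) (z2, v2, t2) =
     (z1 + z2 + (1/2) * (v1 \<bullet> (J_mat *v (R_mat lam t1 *v v2))),
      v1 + R_mat lam t1 *v v2,
      t1 + t2)"

definition osc_group :: "('n::finite \<Rightarrow> real) \<Rightarrow> 'n osc monoid" where
  "osc_group lam = \<lparr>carrier = UNIV, mult = osc_mult lam, one = (0, 0, 0)\<rparr>"

text \<open>The tangent space at every point is identified with the model space by the chart, so the
  differential of a map is its Frechet derivative.\<close>

definition left_diff :: "('n::finite \<Rightarrow> real) \<Rightarrow> 'n osc \<Rightarrow> 'n osc \<Rightarrow> 'n osc \<Rightarrow> 'n osc" where
  "left_diff lam a g = frechet_derivative (\<lambda>x. a \<otimes>\<^bsub>osc_group lam\<^esub> x) (at g)"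

definition right_diff :: "('n::finite \<Rightarrow> real) \<Rightarrow> 'n osc \<Rightarrow> 'n osc \<Rightarrow> 'n osc \<Rightarrow> 'n osc" where
  "right_diff lam a g = frechet_derivative (\<lambda>x. x \<otimes>\<^bsub>osc_group lam\<^esub> a) (at g)"

definition left_inv_field :: "('n::finite \<Rightarrow> real) \<Rightarrow> 'n osc \<Rightarrow> 'n osc \<Rightarrow> 'n osc" where
  "left_inv_field lam A g = left_diff lam g \<one>\<^bsub>osc_group lam\<^esub> A"

definition osc_Z :: "('n::finite) osc" where
  "osc_Z = (1, 0, 0)"

fun osc_form :: "('n::finite \<Rightarrow> real) \<Rightarrow> 'n osc \<Rightarrow> 'n osc \<Rightarrow> real" where
  "osc_form lam (z1, v1, t1) (z2, v2, t2) =
     z1 * t2 + t1 * z2 + (\<Sum>p\<in>UNIV. v1 $ p * v2 $ p / lam (fst p))"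

definition osc_metric :: "('n::finite \<Rightarrow> real) \<Rightarrow> 'n osc \<Rightarrow> 'n osc \<Rightarrow> 'n osc \<Rightarrow> real" where
  "osc_metric lam g u w =
     osc_form lam (left_diff lam (inv\<^bsub>osc_group lam\<^esub> g) g u)
                  (left_diff lam (inv\<^bsub>osc_group lam\<^esub> g) g w)"


section \<open>The quotient by a lattice\<close>

definition osc_proj :: "('n::finite \<Rightarrow> real) \<Rightarrow> 'n osc set \<Rightarrow> 'n osc \<Rightarrow> 'n osc set" where
  "osc_proj lam \<Gamma> g = g <#\<^bsub>osc_group lam\<^esub> \<Gamma>"

definition osc_quot :: "('n::finite \<Rightarrow> real) \<Rightarrow> 'n osc set \<Rightarrow> 'n osc set set" where
  "osc_quot lam \<Gamma> = lcosets\<^bsub>osc_group lam\<^esub> \<Gamma>"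

definition quot_topology :: "('n::finite \<Rightarrow> real) \<Rightarrow> 'n osc set \<Rightarrow> 'n osc set topology" where
  "quot_topology lam \<Gamma> =
     topology (\<lambda>U. U \<subseteq> osc_quot lam \<Gamma> \<and> open {g. osc_proj lam \<Gamma> g \<in> U})"

lemma openin_quot_topology:
  "openin (quot_topology lam \<Gamma>) U \<longleftrightarrow> U \<subseteq> osc_quot lam \<Gamma> \<and> open {g. osc_proj lam \<Gamma> g \<in> U}"
proof -
  have "istopology (\<lambda>U. U \<subseteq> osc_quot lam \<Gamma> \<and> open {g. osc_proj lam \<Gamma> g \<in> U})"
    unfolding istopology_def
  proof (intro conjI allI impI)
    fix S T assume S: "S \<subseteq> osc_quot lam \<Gamma> \<and> open {g. osc_proj lam \<Gamma> g \<in> S}"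
      and T: "T \<subseteq> osc_quot lam \<Gamma> \<and> open {g. osc_proj lam \<Gamma> g \<in> T}"
    show "S \<inter> T \<subseteq> osc_quot lam \<Gamma>" using S by blast
    have "{g. osc_proj lam \<Gamma> g \<in> S \<inter> T} = {g. osc_proj lam \<Gamma> g \<in> S} \<inter> {g. osc_proj lam \<Gamma> g \<in> T}"
      by blast
    then show "open {g. osc_proj lam \<Gamma> g \<in> S \<inter> T}" using S T by (simp add: open_Int)
  next
    fix \<K> assume K: "\<forall>K\<in>\<K>. K \<subseteq> osc_quot lam \<Gamma> \<and> open {g. osc_proj lam \<Gamma> g \<in> K}"
    show "\<Union>\<K> \<subseteq> osc_quot lam \<Gamma>" using K by blast
    have "{g. osc_proj lam \<Gamma> g \<in> \<Union>\<K>} = (\<Union>K\<in>\<K>. {g. osc_proj lam \<Gamma> g \<in> K})" by blast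
    then show "open {g. osc_proj lam \<Gamma> g \<in> \<Union>\<K>}" using K by auto
  qed
  then show ?thesis by (simp add: quot_topology_def topology_inverse')
qed

lemma quotient_map_proj: "quotient_map euclidean (quot_topology lam \<Gamma>) (osc_proj lam \<Gamma>)"
proof -
  have img: "range (osc_proj lam \<Gamma>) = osc_quot lam \<Gamma>"
    by (auto simp: osc_quot_def LCOSETS_def osc_proj_def osc_group_def)
  have "{g. osc_proj lam \<Gamma> g \<in> osc_quot lam \<Gamma>} = UNIV"
    using img by blast
  then have "openin (quot_topology lam \<Gamma>) (osc_quot lam \<Gamma>)"
    by (simp add: openin_quot_topology)
  then have "topspace (quot_topology lam \<Gamma>) = osc_quot lam \<Gamma>"
    using openin_quot_topology[of lam \<Gamma> "topspace (quot_topology lam \<Gamma>)"]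
      openin_subset by blast
  then show ?thesis using img by (simp add: quotient_map_def openin_quot_topology)
qed

definition cocompact_lattice :: "('n::finite \<Rightarrow> real) \<Rightarrow> 'n osc set \<Rightarrow> bool" where
  "cocompact_lattice lam \<Gamma> \<longleftrightarrow>
     subgroup \<Gamma> (osc_group lam) \<and> discrete \<Gamma> \<and> compact_space (quot_topology lam \<Gamma>)"

text \<open>A tangent vector of the quotient is represented by the set of all its lifts: the differential
  of the projection at \<open>g\<close> sends \<open>u\<close> to the orbit of \<open>(g, u)\<close> under right translation by
  \<open>\<Gamma>\<close>. Addition and scaling of tangent vectors at a coset are those of the lifts at any one of its
  elements.\<close>

definition proj_diff ::
    "('n::finite \<Rightarrow> real) \<Rightarrow> 'n osc set \<Rightarrow> 'n osc \<Rightarrow> 'n osc \<Rightarrow> ('n osc \<times> 'n osc) set" where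
  "proj_diff lam \<Gamma> g u =
     (\<lambda>k. (g \<otimes>\<^bsub>osc_group lam\<^esub> k, right_diff lam k g u)) ` \<Gamma>"

text \<open>The metric for which the projection is a local isometry.\<close>

definition quot_metric ::
    "('n::finite \<Rightarrow> real) \<Rightarrow> 'n osc set \<Rightarrow> ('n osc \<times> 'n osc) set \<Rightarrow> ('n osc \<times> 'n osc) set \<Rightarrow> real"
  where
  "quot_metric lam \<Gamma> X Y = (THE r. \<exists>g u w.
     X = proj_diff lam \<Gamma> g u \<and> Y = proj_diff lam \<Gamma> g w \<and> r = osc_metric lam g u w)"

text \<open>Since the projection is a local diffeomorphism, differentiating a curve in the quotient
  means differentiating a local lift.\<close>

definition has_velocity ::
    "('n::finite \<Rightarrow> real) \<Rightarrow> 'n osc set \<Rightarrow> (real \<Rightarrow> 'n osc set) \<Rightarrow> real \<Rightarrow>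
      ('n osc \<times> 'n osc) set \<Rightarrow> bool" where
  "has_velocity lam \<Gamma> c s X \<longleftrightarrow> (\<exists>\<gamma> u.
     (\<forall>\<^sub>F r in nhds s. c r = osc_proj lam \<Gamma> (\<gamma> r)) \<and>
     (\<gamma> has_vector_derivative u) (at s) \<and>
     X = proj_diff lam \<Gamma> (\<gamma> s) u)"

text \<open>Being a geodesic is a local property, and the projection is a local isometry: geodesics of
  the quotient are the curves which near each parameter are projections of geodesics of the
  group.\<close>

definition quot_geodesic_on ::
    "('n::finite \<Rightarrow> real) \<Rightarrow> 'n osc set \<Rightarrow> real set \<Rightarrow> (real \<Rightarrow> 'n osc set) \<Rightarrow> bool" where
  "quot_geodesic_on lam \<Gamma> I c \<longleftrightarrow>
     open I \<and> is_interval I \<and> I \<noteq> {} \<and>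
     (\<forall>s\<in>I. \<exists>J \<gamma>. open J \<and> s \<in> J \<and> geodesic_on (osc_metric lam) J \<gamma> \<and>
        (\<forall>r\<in>J. c r = osc_proj lam \<Gamma> (\<gamma> r)))"

definition maximal_geodesic ::
    "('n::finite \<Rightarrow> real) \<Rightarrow> 'n osc set \<Rightarrow> real set \<Rightarrow> (real \<Rightarrow> 'n osc set) \<Rightarrow> bool" where
  "maximal_geodesic lam \<Gamma> I c \<longleftrightarrow>
     quot_geodesic_on lam \<Gamma> I c \<and>
     (\<forall>I' c'. quot_geodesic_on lam \<Gamma> I' c' \<and> I \<subseteq> I' \<and> (\<forall>s\<in>I. c' s = c s) \<longrightarrow> I' = I)"

text \<open>Constant geodesics are included here, since the zero vector satisfies the equation.\<close>

definition lightlike_geodesic ::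
    "('n::finite \<Rightarrow> real) \<Rightarrow> 'n osc set \<Rightarrow> real set \<Rightarrow> (real \<Rightarrow> 'n osc set) \<Rightarrow> bool" where
  "lightlike_geodesic lam \<Gamma> I c \<longleftrightarrow>
     maximal_geodesic lam \<Gamma> I c \<and>
     (\<forall>s\<in>I. \<exists>X. has_velocity lam \<Gamma> c s X \<and> quot_metric lam \<Gamma> X X = 0)"

text \<open>A maximal geodesic with domain \<open>I\<close> is closed if it is defined for all times and periodic.\<close>

definition closed_geodesic :: "real set \<Rightarrow> (real \<Rightarrow> 'a) \<Rightarrow> bool" where
  "closed_geodesic I c \<longleftrightarrow> I = UNIV \<and> (\<exists>T>0. \<forall>s. c (s + T) = c s)"

text \<open>A direction at a point is a one-dimensional subspace of the tangent space there.\<close>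

definition lightlike_direction ::
    "('n::finite \<Rightarrow> real) \<Rightarrow> 'n osc set \<Rightarrow> 'n osc set \<Rightarrow> ('n osc \<times> 'n osc) set set \<Rightarrow> bool" where
  "lightlike_direction lam \<Gamma> p D \<longleftrightarrow>
     (\<exists>g\<in>p. \<exists>S. subspace S \<and> dim S = 1 \<and> D = proj_diff lam \<Gamma> g ` S) \<and>
     (\<forall>X\<in>D. quot_metric lam \<Gamma> X X = 0)"

text \<open>The initial velocity has to span \<open>D\<close>, so the zero vector is excluded.\<close>

definition lightlike_geodesic_in_direction ::
    "('n::finite \<Rightarrow> real) \<Rightarrow> 'n osc set \<Rightarrow> 'n osc set \<Rightarrow> ('n osc \<times> 'n osc) set set \<Rightarrow>
      real set \<Rightarrow> (real \<Rightarrow> 'n osc set) \<Rightarrow> bool" where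
  "lightlike_geodesic_in_direction lam \<Gamma> p D I c \<longleftrightarrow>
     lightlike_geodesic lam \<Gamma> I c \<and> 0 \<in> I \<and> c 0 = p \<and>
     (\<exists>X\<in>D. has_velocity lam \<Gamma> c 0 X \<and> (\<forall>g. X \<noteq> proj_diff lam \<Gamma> g 0))"

text \<open>As \<open>Z\<close> is central, its left-invariant field is also right-invariant; hence the images of
  its lines at the various elements of a coset coincide, and their union is one line.\<close>

definition Z_direction ::
    "('n::finite \<Rightarrow> real) \<Rightarrow> 'n osc set \<Rightarrow> 'n osc set \<Rightarrow> ('n osc \<times> 'n osc) set set" where
  "Z_direction lam \<Gamma> p = (\<Union>g\<in>p. proj_diff lam \<Gamma> g ` span {left_inv_field lam osc_Z g})"

end

theory Submission
  imports Defs
begin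

text \<open>The metric is bi-invariant, so a geodesic has constant velocity with respect to the
  right-invariant fields, and these fields descend to the quotient by right translations. Hence the
  lightlike geodesics of the quotient are the curves \<open>s \<mapsto> exp(sA) g \<Gamma>\<close> with \<open>A\<close> lightlike, and such a
  curve is closed iff \<open>g\<inverse> exp(rA) g \<in> \<Gamma>\<close> for some \<open>r > 0\<close>. A lightlike \<open>A\<close> is either a multiple of \<open>Z\<close>
  or conjugate to a multiple \<open>\<beta>T\<close> of \<open>T\<close>. In the first case the curve is closed because \<open>\<Gamma>\<close> contains
  a nontrivial element of the central subgroup \<open>exp(\<real>Z)\<close>. In the second case it is closed iff \<open>\<Gamma>\<close> contains a
  conjugate of some \<open>(0, 0, \<tau>)\<close> with \<open>\<tau> \<noteq> 0\<close>; conjugation by its powers moves every element of \<open>\<Gamma>\<close>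
  within a bounded, hence finite, part of \<open>\<Gamma>\<close>, so \<open>R(m\<tau>)\<close> is the identity for some \<open>m \<ge> 1\<close> and
  \<open>(0, 0, m\<tau>)\<close> is a central element of \<open>\<Gamma>\<close>.\<close>

section \<open>The rotations\<close>

text \<open>The two coordinates of a block are read as one complex number, so that \<open>R(t)\<close> multiplies
  the \<open>i\<close>-th block by \<open>cis (lam i * t)\<close>.\<close>

definition blk :: "real ^ ('n \<times> 2) \<Rightarrow> 'n::finite \<Rightarrow> complex" where
  "blk v i = Complex (v $ (i, 1)) (v $ (i, 2))"

lemma Re_blk [simp]: "Re (blk v i) = v $ (i, 1)" and Im_blk [simp]: "Im (blk v i) = v $ (i, 2)"
  by (simp_all add: blk_def)

lemma blk_eq_iff: "v = w \<longleftrightarrow> (\<forall>i. blk v i = blk w i)"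
  by (auto simp: vec_eq_iff complex_eq_iff forall_2)

lemma blk_linear [simp]:
  "blk 0 i = 0" "blk (v + w) i = blk v i + blk w i" "blk (v - w) i = blk v i - blk w i"
  "blk (- v) i = - blk v i" "blk (r *\<^sub>R v) i = r *\<^sub>R blk v i"
  by (simp_all add: complex_eq_iff)

lemma sum_blocks: "(\<Sum>p\<in>UNIV. f p) = (\<Sum>i\<in>UNIV. f (i, 1) + f (i, 2))"
  for f :: "'n::finite \<times> 2 \<Rightarrow> 'a::comm_monoid_add"
  unfolding UNIV_Times_UNIV[symmetric] sum.cartesian_product' by (simp add: sum_2)

lemma blk_N_mat: "blk (N_mat lam *v v) i = \<i> * lam i * blk v i"
proof -
  have "(N_mat lam *v v) $ (i, c) = (\<Sum>j\<in>UNIV. if i = j then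
     J_block (lam i) $ c $ 1 * v $ (i, 1) + J_block (lam i) $ c $ 2 * v $ (i, 2) else 0)" for c
    unfolding matrix_vector_mult_def N_mat_def sum_blocks vec_lambda_beta
    by (intro sum.cong) auto
  then show ?thesis by (simp add: complex_eq_iff J_block_def)
qed

text \<open>The matrix \<open>E\<close> of blockwise multiplication by \<open>exp (z i)\<close> is
  written down first, and the series is shown to sum to it entry by entry, each entry being the real
  or imaginary part of a complex exponential series. Convergence is thus part of the result.\<close>

lemma matrix_exp_component:
  fixes A :: "real ^ ('n::finite \<times> 2) ^ ('n \<times> 2)"
  assumes "\<And>v i. blk (A *v v) i = z i * blk v i"
  shows "blk (matrix_exp A *v v) i = exp (z i) * blk v i"
proof -
  have pow: "blk (((**) A ^^ k) (mat 1) *v v) i = z i ^ k * blk v i" for k v i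
    by (induction k) (simp_all add: assms matrix_vector_mul_assoc[symmetric])
  define E :: "real ^ ('n \<times> 2) ^ ('n \<times> 2)" where "E = matrix (\<lambda>v. \<chi> p. if snd p = 1 then Re (exp (z (fst p)) * blk v (fst p))
    else Im (exp (z (fst p)) * blk v (fst p)))"
  have lin: "linear (\<lambda>v. \<chi> p. if snd p = (1::2) then Re (exp (z (fst p)) * blk v (fst p))
    else Im (exp (z (fst p)) * blk v (fst p)))"
    by (rule linearI) (auto simp: vec_eq_iff algebra_simps)
  have E: "blk (E *v v) i = exp (z i) * blk v i" for v i
    unfolding E_def using matrix_works[OF linear_matrix_vector_mul_eq[THEN iffD2, OF lin]] by (simp add: complex_eq_iff)
  have "(\<lambda>k. ((1 / fact k) *\<^sub>R (((**) A ^^ k) (mat 1))) $ p $ q) sums (E $ p $ q)" for p q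
  proof -
    obtain i c where p: "p = (i, c)" by (cases p)
    \<comment> \<open>An entry in column \<open>q\<close> is a coordinate of the image of
      \<open>axis q 1\<close>, which makes \<open>pow\<close> and \<open>E\<close>
      applicable.\<close>
    have col: "M $ (i, c) $ q = (if c = 1 then Re else Im) (blk (M *v axis q 1) i)"
      for M :: "real ^ ('n \<times> 2) ^ ('n \<times> 2)"
      using exhaust_2[of c] by (auto simp: matrix_vector_mult_basis column_def)
    have "(\<lambda>k. (1 / fact k) *\<^sub>R (z i ^ k * blk (axis q 1) i)) sums (exp (z i) * blk (axis q 1) i)"
      using sums_mult2[OF exp_converges[of "z i"], of "blk (axis q 1) i"]
      by (simp add: divide_inverse)
    from bounded_linear.sums[OF bounded_linear_Re this] bounded_linear.sums[OF bounded_linear_Im this]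
    show ?thesis unfolding p by (auto simp: col pow E)
  qed
  then have "(\<lambda>k. (1 / fact k) *\<^sub>R (((**) A ^^ k) (mat 1))) sums E"
    unfolding sums_def by (intro vec_tendstoI) (simp add: sum_component)
  then show ?thesis by (simp add: matrix_exp_def sums_iff E)
qed

lemma blk_R_mat: "blk (R_mat lam t *v v) i = cis (lam i * t) * blk v i"
proof -
  have "blk ((t *\<^sub>R N_mat lam) *v v) i = (\<i> * (lam i * t)) * blk v i" for v i
    unfolding scaleR_matrix_vector_assoc[symmetric] blk_linear blk_N_mat
    by (simp add: scaleR_conv_of_real)
  then show ?thesis unfolding R_mat_def
    by (subst matrix_exp_component) (auto simp: cis_conv_exp)
qed

lemma has_vector_derivative_Pair:
  assumes "(f has_vector_derivative f') (at x within S)" "(g has_vector_derivative g') (at x within S)"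
  shows "((\<lambda>x. (f x, g x)) has_vector_derivative (f', g')) (at x within S)"
  using has_derivative_Pair[OF assms[unfolded has_vector_derivative_def]]
  by (simp add: has_vector_derivative_def)

lemmas has_vector_derivative_fst = bounded_linear.has_vector_derivative[OF bounded_linear_fst]
lemmas has_vector_derivative_snd = bounded_linear.has_vector_derivative[OF bounded_linear_snd]

lemma has_vector_derivative_matrix_vector_mult:
  fixes A :: "real ^ 'm::finite ^ 'm"
  assumes "(f has_vector_derivative f') (at x within S)"
  shows "((\<lambda>x. A *v f x) has_vector_derivative A *v f') (at x within S)"
  using bounded_linear.has_vector_derivative[OF matrix_vector_mul_bounded_linear assms] .

section \<open>Invariant bilinear forms on the factor R^(2n)\<close>

locale oscillator =
  fixes lam :: "'n::finite \<Rightarrow> real"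
  assumes lam_pos: "lam i > 0"
begin

abbreviation rt :: "real \<Rightarrow> real ^ ('n \<times> 2) \<Rightarrow> real ^ ('n \<times> 2)" where
  "rt t v \<equiv> R_mat lam t *v v"

abbreviation nv :: "real ^ ('n \<times> 2) \<Rightarrow> real ^ ('n \<times> 2)" where
  "nv v \<equiv> N_mat lam *v v"

text \<open>The standard symplectic form: \<open>om v w\<close> is the coefficient of Z in the
  bracket of \<open>v\<close> and \<open>w\<close>.\<close>

definition om :: "real ^ ('n \<times> 2) \<Rightarrow> real ^ ('n \<times> 2) \<Rightarrow> real" where
  "om v w = v \<bullet> (J_mat *v w)"

definition qf :: "real ^ ('n \<times> 2) \<Rightarrow> real ^ ('n \<times> 2) \<Rightarrow> real" where
  "qf v w = (\<Sum>p\<in>UNIV. v $ p * w $ p / lam (fst p))"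

lemma lam_nz [simp]: "lam i \<noteq> 0"
  using lam_pos[of i] by simp

lemma om_blk: "om v w = (\<Sum>i\<in>UNIV. Im (cnj (blk v i) * blk w i))"
proof -
  have "blk (J_mat *v w) i = - \<i> * blk w i" for i
    unfolding J_mat_def blk_N_mat by simp
  then have "(J_mat *v w) $ (i, 1) = w $ (i, 2)" "(J_mat *v w) $ (i, 2) = - w $ (i, 1)" for i
    by (simp_all add: complex_eq_iff)
  then show ?thesis by (simp add: om_def inner_vec_def sum_blocks algebra_simps)
qed

lemma qf_blk: "qf v w = (\<Sum>i\<in>UNIV. Re (cnj (blk v i) * blk w i) / lam i)"
  by (simp add: qf_def sum_blocks add_divide_distrib)

lemma bounded_bilinear_om: "bounded_bilinear om"
  unfolding om_def[abs_def]
  by (rule bounded_bilinear.comp[OF bounded_bilinear_inner bounded_linear_ident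
        matrix_vector_mul_bounded_linear])

lemmas om_linear [simp] =
  bounded_bilinear.add_left[OF bounded_bilinear_om]
  bounded_bilinear.add_right[OF bounded_bilinear_om]
  bounded_bilinear.diff_left[OF bounded_bilinear_om]
  bounded_bilinear.diff_right[OF bounded_bilinear_om]
  bounded_bilinear.minus_left[OF bounded_bilinear_om]
  bounded_bilinear.minus_right[OF bounded_bilinear_om]
  bounded_bilinear.scaleR_left[OF bounded_bilinear_om]
  bounded_bilinear.scaleR_right[OF bounded_bilinear_om]
  bounded_bilinear.zero_left[OF bounded_bilinear_om]
  bounded_bilinear.zero_right[OF bounded_bilinear_om]

lemma matrix_linear [simp]:
  fixes A :: "real ^ ('n \<times> 2) ^ ('n \<times> 2)"
  shows "A *v (v + w) = A *v v + A *v w" "A *v (v - w) = A *v v - A *v w"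
    "A *v (r *\<^sub>R v) = r *\<^sub>R (A *v v)" "A *v (- v) = - (A *v v)"
  using linear_add linear_diff linear_scale linear_neg matrix_vector_mul_linear by blast+

lemma om_skew: "om v w = - om w v"
  unfolding om_blk sum_negf[symmetric] by (intro sum.cong) (auto simp: algebra_simps)

lemma om_self [simp]: "om v v = 0"
  using om_skew[of v v] by simp

lemma cnj_blk_rt: "cnj (blk (rt t v) i) * blk (rt t w) i = cnj (blk v i) * blk w i"
proof -
  have "cnj (blk (rt t v) i) * blk (rt t w) i
      = (cnj (cis (lam i * t)) * cis (lam i * t)) * (cnj (blk v i) * blk w i)"
    by (simp add: blk_R_mat)
  also have "cnj (cis (lam i * t)) * cis (lam i * t) = 1"
    by (simp add: cis_cnj cis_mult)
  finally show ?thesis by simp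
qed

lemma om_rt [simp]: "om (rt t v) (rt t w) = om v w"
  by (simp add: om_blk cnj_blk_rt)

lemma om_nv: "om (nv v) w = - om v (nv w)"
  unfolding om_blk sum_negf[symmetric] blk_N_mat
  by (intro sum.cong refl) (simp add: algebra_simps)

text \<open>This is ad-invariance, <[T,w],v> = <T,[w,v]>: the factor \<lambda> from
  \<open>nv\<close> cancels the weight 1/\<lambda> in \<open>qf\<close>.\<close>

lemma qf_nv: "qf v (nv w) = om w v"
  unfolding om_blk qf_blk blk_N_mat by (intro sum.cong refl) (simp add: field_simps)

lemma qf_sym: "qf v w = qf w v"
  by (simp add: qf_def mult.commute)

lemma qf_linear [simp]:
  "qf (u + v) w = qf u w + qf v w" "qf w (u + v) = qf w u + qf w v"
  "qf (r *\<^sub>R v) w = r * qf v w" "qf v (r *\<^sub>R w) = r * qf v w" "qf 0 w = 0" "qf w 0 = 0"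
  by (simp_all add: qf_def sum.distrib sum_distrib_left algebra_simps add_divide_distrib)

lemma qf_rt [simp]: "qf (rt t v) (rt t w) = qf v w"
  by (simp add: qf_blk cnj_blk_rt)

lemma qf_self_eq_0_iff [simp]: "qf v v = 0 \<longleftrightarrow> v = 0"
proof -
  have "qf v v = 0 \<longleftrightarrow> (\<forall>p\<in>UNIV. v $ p * v $ p / lam (fst p) = 0)"
    unfolding qf_def using lam_pos by (intro sum_nonneg_eq_0_iff) (auto simp: less_imp_le)
  then show ?thesis by (auto simp: vec_eq_iff)
qed

lemma rt_0 [simp]: "rt 0 v = v"
  by (simp add: blk_eq_iff blk_R_mat)

lemma rt_rt [simp]: "rt s (rt t v) = rt (s + t) v"
  by (simp add: blk_eq_iff blk_R_mat cis_mult algebra_simps flip: mult.assoc)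

lemma nv_rt: "nv (rt t v) = rt t (nv v)"
  by (simp add: blk_eq_iff blk_R_mat blk_N_mat algebra_simps)

lemma rt_nth: "rt t v $ (i, 1) = cos (lam i * t) * v $ (i, 1) - sin (lam i * t) * v $ (i, 2)"
  "rt t v $ (i, 2) = sin (lam i * t) * v $ (i, 1) + cos (lam i * t) * v $ (i, 2)"
  using arg_cong[OF blk_R_mat[of lam t v i], of Re] arg_cong[OF blk_R_mat[of lam t v i], of Im]
  by simp_all

lemma nv_nth: "nv v $ (i, 1) = - lam i * v $ (i, 2)" "nv v $ (i, 2) = lam i * v $ (i, 1)"
  using arg_cong[OF blk_N_mat[of lam v i], of Re] arg_cong[OF blk_N_mat[of lam v i], of Im]
  by simp_all

section \<open>Derivatives of the rotations and of the symplectic form\<close>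

lemma has_derivative_rt [derivative_intros]:
  assumes f: "(f has_derivative f') (at x within S)" and w: "(w has_derivative w') (at x within S)"
  shows "((\<lambda>x. rt (f x) (w x)) has_derivative
     (\<lambda>h. f' h *\<^sub>R nv (rt (f x) (w x)) + rt (f x) (w' h))) (at x within S)"
proof -
  have w1: "((\<lambda>x. w x $ p) has_derivative (\<lambda>h. w' h $ p)) (at x within S)" for p
    using bounded_linear.has_derivative[OF bounded_linear_vec_nth w] .
  have "((\<lambda>x. rt (f x) (w x) $ p) has_derivative
      (\<lambda>h. (f' h *\<^sub>R nv (rt (f x) (w x)) + rt (f x) (w' h)) $ p)) (at x within S)" for p
  proof -
    obtain i c where p: "p = (i, c)" by (cases p)
    show ?thesis unfolding p using exhaust_2[of c]
      by (elim disjE; simp add: rt_nth nv_nth)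
        (rule derivative_eq_intros f w1 refl ext | simp add: algebra_simps)+
  qed
  then show ?thesis
    unfolding has_derivative_componentwise_within[of "\<lambda>x. rt (f x) (w x)"]
    by (auto simp: Basis_vec_def inner_axis)
qed

lemmas has_derivative_om [derivative_intros] = bounded_bilinear.FDERIV[OF bounded_bilinear_om]

lemma has_vector_derivative_rt [derivative_intros]:
  assumes "(f has_vector_derivative f') (at x within S)" "(w has_vector_derivative w') (at x within S)"
  shows "((\<lambda>x. rt (f x) (w x)) has_vector_derivative
     (f' *\<^sub>R nv (rt (f x) (w x)) + rt (f x) w')) (at x within S)"
  using has_derivative_rt[OF assms[unfolded has_vector_derivative_def]]
  by (simp add: has_vector_derivative_def algebra_simps)

lemmas has_vector_derivative_om [derivative_intros] =
  bounded_bilinear.has_vector_derivative[OF bounded_bilinear_om]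


section \<open>The group\<close>

abbreviation mul :: "'n osc \<Rightarrow> 'n osc \<Rightarrow> 'n osc" (infixl "\<odot>" 70) where
  "x \<odot> y \<equiv> x \<otimes>\<^bsub>osc_group lam\<^esub> y"

abbreviation iv :: "'n osc \<Rightarrow> 'n osc" where
  "iv x \<equiv> inv\<^bsub>osc_group lam\<^esub> x"

lemma carrier_osc [simp]: "carrier (osc_group lam) = UNIV"
  and one_osc [simp]: "\<one>\<^bsub>osc_group lam\<^esub> = (0, 0, 0)"
  by (simp_all add: osc_group_def)

lemma mul_osc [simp]:
  "(z1, v1, t1) \<odot> (z2, v2, t2) = (z1 + z2 + om v1 (rt t1 v2) / 2, v1 + rt t1 v2, t1 + t2)"
  by (simp add: osc_group_def om_def)

lemma mul_components:
  "x \<odot> y = (fst x + fst y + om (fst (snd x)) (rt (snd (snd x)) (fst (snd y))) / 2,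
     fst (snd x) + rt (snd (snd x)) (fst (snd y)), snd (snd x) + snd (snd y))"
  by (cases x; cases y) simp

sublocale group "osc_group lam"
proof (rule groupI)
  fix x y z :: "'n osc"
  obtain z1 v1 t1 z2 v2 t2 z3 v3 t3
    where e: "x = (z1, v1, t1)" "y = (z2, v2, t2)" "z = (z3, v3, t3)"
    by (metis prod_cases3)
  \<comment> \<open>Rotation invariance of \<open>om\<close> yields the cocycle identity behind
    associativity.\<close>
  have "om (rt t1 v2) (rt (t1 + t2) v3) = om v2 (rt t2 v3)"
    using om_rt[of t1 v2 "rt t2 v3"] by simp
  then show "x \<odot> y \<odot> z = x \<odot> (y \<odot> z)"
    by (simp add: e algebra_simps add_divide_distrib)
  have "(- z1, - rt (- t1) v1, - t1) \<odot> x = \<one>\<^bsub>osc_group lam\<^esub>"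
    by (simp add: e)
  then show "\<exists>y\<in>carrier (osc_group lam). y \<odot> x = \<one>\<^bsub>osc_group lam\<^esub>" by auto
qed (auto simp: split_paired_all)

lemma mul_cancel [simp]:
  "(0, 0, 0) \<odot> x = x" "x \<odot> (0, 0, 0) = x" "iv x \<odot> x = (0, 0, 0)" "x \<odot> iv x = (0, 0, 0)"
  "iv x \<odot> (x \<odot> y) = y" "x \<odot> (iv x \<odot> y) = y"
  using l_one[of x] r_one[of x] l_inv[of x] r_inv[of x] m_assoc[of "iv x" x y] m_assoc[of x "iv x" y]
    l_one[of y]
  by simp_all

lemma iv_osc [simp]: "iv (z, v, t) = (- z, - rt (- t) v, - t)"
  by (rule inv_equality) simp_all

lemma has_derivative_mul:
  assumes "(f has_derivative f') (at x within S)" "(g has_derivative g') (at x within S)"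
  shows "((\<lambda>x. f x \<odot> g x) has_derivative (\<lambda>h.
    (fst (f' h) + fst (g' h)
      + (om (fst (snd (f' h))) (rt (snd (snd (f x))) (fst (snd (g x))))
         + om (fst (snd (f x))) (snd (snd (f' h)) *\<^sub>R nv (rt (snd (snd (f x))) (fst (snd (g x))))
             + rt (snd (snd (f x))) (fst (snd (g' h))))) / 2,
     fst (snd (f' h)) + snd (snd (f' h)) *\<^sub>R nv (rt (snd (snd (f x))) (fst (snd (g x))))
       + rt (snd (snd (f x))) (fst (snd (g' h))),
     snd (snd (f' h)) + snd (snd (g' h))))) (at x within S)"
  unfolding mul_components
  by (rule derivative_eq_intros assms refl ext | simp add: add.commute add.left_commute)+

lemma tendsto_mul [tendsto_intros]:
  assumes "(f \<longlongrightarrow> a) F" "(g \<longlongrightarrow> b) F"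
  shows "((\<lambda>x. f x \<odot> g x) \<longlongrightarrow> a \<odot> b) F"
proof -
  have "isCont (\<lambda>p. fst p \<odot> snd p) (a, b)"
    by (rule has_derivative_continuous, rule has_derivative_mul) (rule derivative_intros)+
  from isCont_tendsto_compose[OF this tendsto_Pair[OF assms]] show ?thesis by simp
qed

lemma tendsto_iv [tendsto_intros]:
  assumes "(f \<longlongrightarrow> a) F"
  shows "((\<lambda>x. iv (f x)) \<longlongrightarrow> iv a) F"
proof -
  have iv: "iv p = (- fst p, - rt (- snd (snd p)) (fst (snd p)), - snd (snd p))" for p
    by (cases p) simp
  have "\<exists>D. (iv has_derivative D) (at a)"
    unfolding iv by (rule exI, (rule derivative_intros)+)
  then have "isCont iv a" by (auto intro: has_derivative_continuous)
  from isCont_tendsto_compose[OF this assms] show ?thesis .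
qed

text \<open>The right-invariant vector field with value \<open>A\<close> at the identity, that is,
  the derivative of exp(sA) g at s = 0.\<close>

fun RF :: "'n osc \<Rightarrow> 'n osc \<Rightarrow> 'n osc" where
  "RF (\<alpha>, w, \<beta>) (z, v, t) = (\<alpha> + om w v / 2, w + \<beta> *\<^sub>R nv v, \<beta>)"

lemma left_diff_osc:
  "left_diff lam (z, v, t) g (a, u, b) = (a + om v (rt t u) / 2, rt t u, b)"
  unfolding left_diff_def
  by (subst frechet_derivative_at[OF has_derivative_mul[OF has_derivative_const has_derivative_ident], symmetric]) simp

text \<open>Right translations carry the field to itself, which is why it descends to the quotient
  by right multiplication with \<Gamma>.\<close>

lemma right_diff_RF: "right_diff lam k g (RF A g) = RF A (g \<odot> k)"
  unfolding right_diff_def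
  by (subst frechet_derivative_at[OF has_derivative_mul[OF has_derivative_ident has_derivative_const], symmetric],
      cases A; cases g; cases k) (simp add: om_nv add_divide_distrib algebra_simps)

lemma RF_inj: "RF A g = RF B g \<Longrightarrow> A = B"
  by (cases A; cases B; cases g) auto

lemma RF_surj: "\<exists>A. u = RF A g"
proof -
  obtain a w b z v t where "u = (a, w, b)" "g = (z, v, t)" by (metis prod_cases3)
  then have "u = RF (a - om (w - b *\<^sub>R nv v) v / 2, w - b *\<^sub>R nv v, b) g" by simp
  then show ?thesis ..
qed

text \<open>The rotations cancel because \<open>qf\<close> is invariant, so the coefficients depend
  only on \<open>v\<close>, and affinely; this keeps the Koszul formula elementary.\<close>

lemma metric_osc:
  "osc_metric lam (z, v, t) (a1, u1, b1) (a2, u2, b2)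
     = a1 * b2 + b1 * a2 - (b2 * om v u1 + b1 * om v u2) / 2 + qf u1 u2"
proof -
  have 1: "(\<Sum>p\<in>UNIV. rt (- t) u1 $ p * rt (- t) u2 $ p / lam (fst p)) = qf u1 u2"
    using qf_rt[of "- t" u1 u2] unfolding qf_def[of "rt _ _"] .
  show ?thesis
    by (simp add: osc_metric_def left_diff_osc 1 algebra_simps add_divide_distrib)
qed

lemma osc_form_qf: "osc_form lam (z1, v1, t1) (z2, v2, t2) = z1 * t2 + t1 * z2 + qf v1 v2"
  by (simp add: qf_def)

text \<open>Bi-invariance: the metric is built from left translations, but by ad-invariance
  (\<open>qf_nv\<close>) it also has constant coefficients in the right-invariant frame.\<close>

lemma metric_RF: "osc_metric lam g (RF A g) (RF B g) = osc_form lam A B"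
proof -
  obtain a1 w1 b1 a2 w2 b2 z v t where e: "A = (a1, w1, b1)" "B = (a2, w2, b2)" "g = (z, v, t)"
    by (metis prod_cases3)
  show ?thesis unfolding e
    by (simp add: metric_osc osc_form_qf qf_nv qf_sym[of "nv v"] om_skew[of v w1] om_skew[of v w2]
        algebra_simps add_divide_distrib diff_divide_distrib del: osc_form.simps)
qed

section \<open>Geodesics of the group\<close>

lemma frechet_derivative_metric:
  "frechet_derivative (\<lambda>q. osc_metric lam q (a1, u1, b1) (a2, u2, b2)) (at p) (a, u, b)
     = - (b2 * om u u1 + b1 * om u u2) / 2"
proof -
  have m: "osc_metric lam q (a1, u1, b1) (a2, u2, b2) =
      a1 * b2 + b1 * a2 - (b2 * om (fst (snd q)) u1 + b1 * om (fst (snd q)) u2) / 2 + qf u1 u2" for q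
    by (cases q) (simp add: metric_osc)
  have "((\<lambda>q. osc_metric lam q (a1, u1, b1) (a2, u2, b2)) has_derivative
      (\<lambda>x. - (b2 * om (fst (snd x)) u1 + b1 * om (fst (snd x)) u2) / 2)) (at p)"
    unfolding m by (rule derivative_eq_intros refl ext | simp add: algebra_simps)+
  from frechet_derivative_at[OF this, symmetric] show ?thesis by simp
qed

text \<open>Supplies the uniqueness required by the definite description in
  \<open>christoffel\<close>.\<close>

lemma metric_nondegenerate:
  assumes "\<And>x. osc_metric lam p w x = osc_metric lam p w' x"
  shows "w = w'"
proof -
  obtain z v t a u b a' u' b' where e: "p = (z, v, t)" "w = (a, u, b)" "w' = (a', u', b')"
    by (metis prod_cases3)
  have b: "b = b'" using assms[of "(1, 0, 0)"] by (simp add: e metric_osc)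
  have a: "a - om v u / 2 = a' - om v u' / 2"
    using assms[of "(0, 0, 1)"] by (simp add: e metric_osc)
  have "qf u (u - u') = qf u' (u - u')"
    using assms[of "(0, u - u', 0)"] by (simp add: e metric_osc b)
  then have "qf (u + (-1) *\<^sub>R u') (u - u') = 0"
    unfolding qf_linear by simp
  then have "u = u'" by simp
  then show ?thesis using a b by (simp add: e)
qed

text \<open>Only the diagonal values enter the geodesic equation. The derivative terms of the Koszul
  formula are values of \<open>om\<close>, which \<open>qf_nv\<close> turns into pairings with
  \<open>nv u\<close>.\<close>

lemma christoffel_osc:
  "christoffel (osc_metric lam) (z, v, t) (a, u, b) (a, u, b)
     = (- b * om v (nv u) / 2, - b *\<^sub>R nv u, 0)"
  unfolding christoffel_def
proof (rule the_equality)
  show eq: "\<forall>x. osc_metric lam (z, v, t) (- b * om v (nv u) / 2, - b *\<^sub>R nv u, 0) x =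
    (frechet_derivative (\<lambda>q. osc_metric lam q (a, u, b) x) (at (z, v, t)) (a, u, b)
     + frechet_derivative (\<lambda>q. osc_metric lam q (a, u, b) x) (at (z, v, t)) (a, u, b)
     - frechet_derivative (\<lambda>q. osc_metric lam q (a, u, b) (a, u, b)) (at (z, v, t)) x) / 2"
    (is "\<forall>x. _ = ?K x")
  proof
    fix x :: "'n osc"
    obtain a' u' b' where x: "x = (a', u', b')" by (metis prod_cases3)
    have "qf (nv u) u' = om u u'" using qf_nv[of u' u] qf_sym[of "nv u" u'] by simp
    then have "qf (- b *\<^sub>R nv u) u' = - b * om u u'" unfolding qf_linear by simp
    then show "osc_metric lam (z, v, t) (- b * om v (nv u) / 2, - b *\<^sub>R nv u, 0) x = ?K x"
      unfolding x using om_skew[of u' u]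
      by (simp add: metric_osc frechet_derivative_metric field_simps)
  qed
  fix w assume "\<forall>x. osc_metric lam (z, v, t) w x = ?K x"
  then show "w = (- b * om v (nv u) / 2, - b *\<^sub>R nv u, 0)"
    using eq by (intro metric_nondegenerate[of "(z, v, t)"]) metis
qed

lemma RF_components:
  "RF A g = (fst A + om (fst (snd A)) (fst (snd g)) / 2,
     fst (snd A) + snd (snd A) *\<^sub>R nv (fst (snd g)), snd (snd A))"
  by (cases A; cases g) simp

text \<open>One half of the description of geodesics as integral curves of right-invariant fields;
  here \<open>A\<close> is arbitrary.\<close>

lemma geodesic_on_RF:
  assumes "\<And>s. s \<in> I \<Longrightarrow> (\<gamma> has_vector_derivative RF A (\<gamma> s)) (at s)"
  shows "geodesic_on (osc_metric lam) I \<gamma>"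
  unfolding geodesic_on_def
proof (intro exI ballI conjI)
  fix s assume s: "s \<in> I"
  obtain \<alpha> w \<beta> z v t where A: "A = (\<alpha>, w, \<beta>)" and \<gamma>: "\<gamma> s = (z, v, t)"
    by (metis prod_cases3)
  define u where "u = w + \<beta> *\<^sub>R nv v"
  show 1: "(\<gamma> has_vector_derivative RF A (\<gamma> s)) (at s)" by (rule assms[OF s])
  have v': "((\<lambda>s. fst (snd (\<gamma> s))) has_vector_derivative fst (snd (RF A (\<gamma> s)))) (at s)"
    by (intro has_vector_derivative_fst has_vector_derivative_snd 1)
  let ?\<gamma>'' = "\<lambda>s. let u = fst (snd (RF A (\<gamma> s))) in (om (fst (snd A)) u / 2, snd (snd A) *\<^sub>R nv u, 0)"
  show "((\<lambda>s. RF A (\<gamma> s)) has_vector_derivative ?\<gamma>'' s) (at s)"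
    unfolding RF_components[of A "\<gamma> _"] Let_def fst_conv snd_conv
    by (rule has_vector_derivative_eq_rhs, rule has_vector_derivative_Pair[OF
        has_vector_derivative_add[OF has_vector_derivative_const
          has_vector_derivative_divide[OF has_vector_derivative_om[OF has_vector_derivative_const v']]]
        has_vector_derivative_Pair[OF
          has_vector_derivative_add[OF has_vector_derivative_const
            has_vector_derivative_scaleR[OF DERIV_const has_vector_derivative_matrix_vector_mult[OF v']]]
          has_vector_derivative_const]])
      (simp add: RF_components)
  \<comment> \<open>The z-component of the equation: \<open>om u u\<close> vanishes, so only the
    part of \<open>w\<close> along \<open>nv v\<close> contributes.\<close>
  have "om w u = \<beta> * om v (nv u)"
  proof -
    have "om w u = om (u - \<beta> *\<^sub>R nv v) u" by (simp add: u_def)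
    also have "\<dots> = \<beta> * om v (nv u)" unfolding om_linear om_nv by simp
    finally show ?thesis .
  qed
  then show "?\<gamma>'' s + christoffel (osc_metric lam) (\<gamma> s) (RF A (\<gamma> s)) (RF A (\<gamma> s)) = 0"
    by (simp add: A \<gamma> christoffel_osc zero_prod_def flip: u_def)
qed

text \<open>The converse: the components of the velocity in the right-invariant frame have
  derivative zero by the geodesic equation, hence are constant on the convex set
  \<open>J\<close>.\<close>

lemma geodesic_on_imp_RF:
  assumes geo: "geodesic_on (osc_metric lam) J \<gamma>" and J: "open J" "convex J"
  obtains A where "\<And>s. s \<in> J \<Longrightarrow> (\<gamma> has_vector_derivative RF A (\<gamma> s)) (at s)"
proof -
  obtain \<gamma>' \<gamma>'' where d1: "\<And>s. s \<in> J \<Longrightarrow> (\<gamma> has_vector_derivative \<gamma>' s) (at s)"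
    and d2: "\<And>s. s \<in> J \<Longrightarrow> (\<gamma>' has_vector_derivative \<gamma>'' s) (at s)"
    and eq: "\<And>s. s \<in> J \<Longrightarrow> \<gamma>'' s + christoffel (osc_metric lam) (\<gamma> s) (\<gamma>' s) (\<gamma>' s) = 0"
    using geo unfolding geodesic_on_def by metis
  define v where "v s = fst (snd (\<gamma> s))" for s
  define b where "b s = snd (snd (\<gamma>' s))" for s
  define w where "w s = fst (snd (\<gamma>' s)) - b s *\<^sub>R nv (v s)" for s
  \<comment> \<open>Solves the triangular system \<open>\<gamma>' s = RF (A s) (\<gamma> s)\<close>
    for \<open>A s\<close>.\<close>
  define A where "A s = (fst (\<gamma>' s) - om (w s) (v s) / 2, w s, b s)" for s
  have RF: "\<gamma>' s = RF (A s) (\<gamma> s)" for s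
    by (simp add: A_def w_def b_def v_def RF_components)
  have "(A has_vector_derivative 0) (at s)" if s: "s \<in> J" for s
  proof -
    obtain a u \<beta> z x t where \<gamma>': "\<gamma>' s = (a, u, \<beta>)" and \<gamma>: "\<gamma> s = (z, x, t)"
      by (metis prod_cases3)
    have \<gamma>'': "\<gamma>'' s = (\<beta> * om x (nv u) / 2, \<beta> *\<^sub>R nv u, 0)"
      using eq[OF s] unfolding \<gamma>' \<gamma> christoffel_osc
      by (cases "\<gamma>'' s") (simp add: zero_prod_def algebra_simps)
    have v': "(v has_vector_derivative u) (at s)"
      unfolding v_def using has_vector_derivative_fst[OF has_vector_derivative_snd[OF d1[OF s]]]
      by (simp add: \<gamma>')
    have b': "(b has_vector_derivative 0) (at s)"
      unfolding b_def using has_vector_derivative_snd[OF has_vector_derivative_snd[OF d2[OF s]]]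
      by (simp add: \<gamma>'')
    have u': "((\<lambda>s. fst (snd (\<gamma>' s))) has_vector_derivative \<beta> *\<^sub>R nv u) (at s)"
      using has_vector_derivative_fst[OF has_vector_derivative_snd[OF d2[OF s]]]
      by (simp add: \<gamma>'')
    have a': "((\<lambda>s. fst (\<gamma>' s)) has_vector_derivative \<beta> * om x (nv u) / 2) (at s)"
      using has_vector_derivative_fst[OF d2[OF s]] by (simp add: \<gamma>'')
    have w': "(w has_vector_derivative 0) (at s)"
      using has_vector_derivative_diff[OF u'
          bounded_bilinear.has_vector_derivative[OF bounded_bilinear_scaleR b'
            has_vector_derivative_matrix_vector_mult[OF v', of "N_mat lam"]]]
      by (simp add: w_def[abs_def] b_def \<gamma>')
    have "om (w s) u = \<beta> * om x (nv u)"
      by (simp add: w_def b_def v_def \<gamma>' \<gamma> om_nv)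
    then have "((\<lambda>s. fst (\<gamma>' s) - om (w s) (v s) / 2) has_vector_derivative 0) (at s)"
      using has_vector_derivative_diff[OF a' has_vector_derivative_divide[OF
          has_vector_derivative_om[OF w' v'], of 2]] by simp
    then show ?thesis
      using has_vector_derivative_Pair[OF _ has_vector_derivative_Pair[OF w' b']]
      by (simp add: A_def[abs_def] zero_prod_def)
  qed
  then have "\<And>s. s \<in> J \<Longrightarrow> (A has_vector_derivative 0) (at s within J)"
    by (rule has_vector_derivative_at_within)
  then obtain A0 where "\<And>s. s \<in> J \<Longrightarrow> A s = A0"
    using has_vector_derivative_zero_constant[OF J(2)] by metis
  with d1 RF that show thesis by metis
qed

text \<open>This is the exponential map only for lightlike \<open>A\<close>. If \<open>\<beta> \<noteq> 0\<close>, then conjugation by \<open>(0, h, 0)\<close>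
  takes the multiple \<open>\<beta>T\<close> of \<open>T\<close> to \<open>A\<close> when \<open>\<beta> N h = - w\<close>.\<close>

fun osc_exp :: "'n osc \<Rightarrow> real \<Rightarrow> 'n osc" where
  "osc_exp (\<alpha>, w, \<beta>) s = (if \<beta> = 0 then (s * \<alpha>, 0, 0)
     else let h = (1 / \<beta>) *\<^sub>R (N_mat (\<lambda>i. 1 / lam i) *v w)
       in (0, h, 0) \<odot> (0, 0, \<beta> * s) \<odot> (0, - h, 0))"

text \<open>If \<beta> = 0, positive definiteness of \<open>qf\<close> forces \<open>w\<close> = 0.
  Otherwise the null equation determines \<alpha> from \<open>w\<close> and \<beta>, and since N is
  invertible, \<open>A\<close> is a conjugate of \<beta>T.\<close>

lemma lightlike_cases:
  assumes "osc_form lam A A = 0"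
  obtains (vertical) \<alpha> where "A = (\<alpha>, 0, 0)" "osc_exp A = (\<lambda>s. (s * \<alpha>, 0, 0))"
  | (transversal) \<beta> h where "\<beta> \<noteq> 0" "A = (- \<beta> * om h (nv h) / 2, - \<beta> *\<^sub>R nv h, \<beta>)"
      "osc_exp A = (\<lambda>s. (0, h, 0) \<odot> (0, 0, \<beta> * s) \<odot> (0, - h, 0))"
proof -
  obtain \<alpha> w \<beta> where A: "A = (\<alpha>, w, \<beta>)" by (metis prod_cases3)
  have ll: "2 * \<alpha> * \<beta> + qf w w = 0"
    using assms by (simp add: A osc_form_qf del: osc_form.simps)
  show thesis
  proof (cases "\<beta> = 0")
    case True
    then have "A = (\<alpha>, 0, 0)" "osc_exp A = (\<lambda>s. (s * \<alpha>, 0, 0))" using ll by (auto simp: A)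
    then show thesis by (rule vertical)
  next
    case False
    \<comment> \<open>The matrix with entries 1/\<lambda> is minus the inverse of N, so this
      \<open>h\<close> solves \<open>w = - \<beta> *\<^sub>R nv h\<close>.\<close>
    define h where "h = (1 / \<beta>) *\<^sub>R (N_mat (\<lambda>i. 1 / lam i) *v w)"
    have w: "w = - \<beta> *\<^sub>R nv h"
      by (simp add: h_def blk_eq_iff blk_N_mat False)
    have "qf w w = \<beta> * \<beta> * om h (nv h)"
      unfolding w qf_linear by (simp add: qf_nv)
    with ll have "\<beta> * (2 * \<alpha> + \<beta> * om h (nv h)) = 0" by (simp add: algebra_simps)
    then have \<alpha>: "\<alpha> = - \<beta> * om h (nv h) / 2" using False by simp
    have "osc_exp A = (\<lambda>s. (0, h, 0) \<odot> (0, 0, \<beta> * s) \<odot> (0, - h, 0))"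
      using False by (simp add: A h_def Let_def fun_eq_iff)
    then show thesis
      using False A[unfolded \<alpha> w] by (intro transversal)
  qed
qed

lemma osc_exp_0 [simp]: "osc_form lam A A = 0 \<Longrightarrow> osc_exp A 0 = (0, 0, 0)"
  by (erule lightlike_cases) simp_all

lemma osc_exp_add:
  assumes "osc_form lam A A = 0"
  shows "osc_exp A (s + t) = osc_exp A s \<odot> osc_exp A t"
  using assms
proof (cases rule: lightlike_cases)
  case (transversal \<beta> h)
  have "om (rt (\<beta> * s) h) (rt (\<beta> * s + \<beta> * t) h) = om h (rt (\<beta> * t) h)"
    using om_rt[of "\<beta> * s" h "rt (\<beta> * t) h"] by simp
  then show ?thesis
    using om_skew[of "rt (\<beta> * s) h" h]
    by (simp add: transversal(3) algebra_simps add_divide_distrib diff_divide_distrib)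
qed (simp add: algebra_simps)

lemma osc_exp_minus:
  assumes "osc_form lam A A = 0"
  shows "osc_exp A (- s) = iv (osc_exp A s)"
  using osc_exp_add[OF assms, of "- s" s] inv_equality[of "osc_exp A (- s)" "osc_exp A s"]
  by (simp add: assms)

lemma osc_exp_deriv:
  assumes "osc_form lam A A = 0"
  shows "((\<lambda>s. osc_exp A s \<odot> g) has_vector_derivative RF A (osc_exp A s \<odot> g)) (at s)"
  using assms
proof (cases rule: lightlike_cases)
  case (vertical \<alpha>)
  obtain z v t where g: "g = (z, v, t)" by (metis prod_cases3)
  have "((\<lambda>s. s * \<alpha> + z) has_vector_derivative \<alpha>) (at s)"
    by (rule derivative_eq_intros refl | simp)+
  then have "((\<lambda>s. (s * \<alpha> + z, v, t)) has_vector_derivative (\<alpha>, 0, 0)) (at s)"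
    by (intro has_vector_derivative_Pair has_vector_derivative_const)
  then show ?thesis by (simp add: vertical(2) g) (simp add: vertical(1))
next
  case (transversal \<beta> h)
  obtain z v t where g: "g = (z, v, t)" by (metis prod_cases3)
  have e: "osc_exp A s \<odot> g = (z - om h v / 2 + om h (rt (\<beta> * s) (v - h)) / 2,
      h + rt (\<beta> * s) (v - h), \<beta> * s + t)" for s
  proof -
    have "osc_exp A s \<odot> g = (0, h, 0) \<odot> ((0, 0, \<beta> * s) \<odot> ((0, - h, 0) \<odot> g))"
      by (simp add: transversal(3) m_assoc del: mul_osc)
    then show ?thesis by (simp add: g)
  qed
  have b: "((\<lambda>s. \<beta> * s) has_vector_derivative \<beta>) (at s)"
    by (rule derivative_eq_intros refl | simp)+
  from has_vector_derivative_rt[OF b has_vector_derivative_const, of "v - h"]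
  have r: "((\<lambda>s. rt (\<beta> * s) (v - h)) has_vector_derivative \<beta> *\<^sub>R nv (rt (\<beta> * s) (v - h))) (at s)"
    by simp
  have "((\<lambda>s. osc_exp A s \<odot> g) has_vector_derivative
     (\<beta> * om h (nv (rt (\<beta> * s) (v - h))) / 2, \<beta> *\<^sub>R nv (rt (\<beta> * s) (v - h)), \<beta>)) (at s)"
    unfolding e
    by (rule has_vector_derivative_eq_rhs, rule has_vector_derivative_Pair[OF
        has_vector_derivative_add[OF has_vector_derivative_const
          has_vector_derivative_divide[OF has_vector_derivative_om[OF has_vector_derivative_const r]]]
        has_vector_derivative_Pair[OF
          has_vector_derivative_add[OF has_vector_derivative_const r]
          has_vector_derivative_add[OF b has_vector_derivative_const]]])
      simp
  moreover have "RF A (osc_exp A s \<odot> g) =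
     (\<beta> * om h (nv (rt (\<beta> * s) (v - h))) / 2, \<beta> *\<^sub>R nv (rt (\<beta> * s) (v - h)), \<beta>)"
    unfolding e
    by (simp add: transversal(2) om_nv algebra_simps add_divide_distrib diff_divide_distrib)
  ultimately show ?thesis by simp
qed

text \<open>Uniqueness of integral curves, obtained directly: moving \<open>\<gamma> r\<close> back
  by \<open>osc_exp A (- r)\<close> gives a curve with derivative zero, up to a fixed left
  factor.\<close>

lemma osc_exp_flow:
  assumes A: "osc_form lam A A = 0" and J: "convex J"
    and d: "\<And>r. r \<in> J \<Longrightarrow> (\<gamma> has_vector_derivative RF A (\<gamma> r)) (at r)"
    and rs: "r \<in> J" "s \<in> J"
  shows "\<gamma> r = osc_exp A (r - s) \<odot> \<gamma> s"
proof -
  obtain z v t where \<gamma>: "\<And>r. \<gamma> r = (z r, v r, t r)"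
    by (rule that[of "\<lambda>r. fst (\<gamma> r)" "\<lambda>r. fst (snd (\<gamma> r))" "\<lambda>r. snd (snd (\<gamma> r))"]) simp
  have const: "f r = f s" if "\<And>r. r \<in> J \<Longrightarrow> (f has_vector_derivative 0) (at r)"
    for f :: "real \<Rightarrow> 'n osc"
    using has_vector_derivative_zero_constant[OF J, of f] has_vector_derivative_at_within[OF that] rs
    by metis
  have dz: "(z has_vector_derivative fst (RF A (\<gamma> r))) (at r)"
    and dv: "(v has_vector_derivative fst (snd (RF A (\<gamma> r)))) (at r)"
    and dt: "(t has_vector_derivative snd (snd (RF A (\<gamma> r)))) (at r)" if "r \<in> J" for r
    using has_vector_derivative_fst[OF d[OF that]]
      has_vector_derivative_fst[OF has_vector_derivative_snd[OF d[OF that]]]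
      has_vector_derivative_snd[OF has_vector_derivative_snd[OF d[OF that]]]
    by (simp_all add: \<gamma>)
  have "osc_exp A (- r) \<odot> \<gamma> r = osc_exp A (- s) \<odot> \<gamma> s"
    using A
  proof (cases rule: lightlike_cases)
    case (vertical \<alpha>)
    have "((\<lambda>r. (z r - r * \<alpha>, v r, t r)) has_vector_derivative 0) (at r)" if "r \<in> J" for r
    proof -
      have "((\<lambda>r. r * \<alpha>) has_vector_derivative \<alpha>) (at r)"
        by (rule derivative_eq_intros refl | simp)+
      from has_vector_derivative_Pair[OF has_vector_derivative_diff[OF dz[OF that] this]
          has_vector_derivative_Pair[OF dv[OF that] dt[OF that]]]
      show ?thesis by (simp add: vertical(1) \<gamma> zero_prod_def)
    qed
    from const[OF this] show ?thesis by (simp add: vertical(2) \<gamma>)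
  next
    case (transversal \<beta> h)
    \<comment> \<open>These are the coordinates of \<open>osc_exp A (- r) \<odot> \<gamma> r\<close>
      without its constant left factor \<open>(0, h, 0)\<close>.\<close>
    have "((\<lambda>r. (z r - om h (v r) / 2, rt (- (\<beta> * r)) (v r - h), t r - \<beta> * r))
      has_vector_derivative 0) (at r)" if r: "r \<in> J" for r
    proof -
      have dv': "(v has_vector_derivative \<beta> *\<^sub>R nv (v r - h)) (at r)"
        using dv[OF r] by (simp add: transversal(2) \<gamma> algebra_simps)
      have "((\<lambda>r. z r - om h (v r) / 2) has_vector_derivative 0) (at r)"
        using has_vector_derivative_diff[OF dz[OF r] has_vector_derivative_divide[OF
            has_vector_derivative_om[OF has_vector_derivative_const dv'], of h 2]]
        by (simp add: transversal(2) \<gamma> om_nv field_simps)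
      moreover have "((\<lambda>r. t r - \<beta> * r) has_vector_derivative 0) (at r)"
      proof -
        have "((\<lambda>r. \<beta> * r) has_vector_derivative \<beta>) (at r)"
          by (rule derivative_eq_intros refl | simp)+
        from has_vector_derivative_diff[OF dt[OF r] this]
        show ?thesis by (simp add: transversal(2) \<gamma>)
      qed
      moreover have "((\<lambda>r. rt (- (\<beta> * r)) (v r - h)) has_vector_derivative 0) (at r)"
      proof -
        have "((\<lambda>r. - (\<beta> * r)) has_vector_derivative - \<beta>) (at r)"
          by (rule derivative_eq_intros refl | simp)+
        from has_vector_derivative_rt[OF this has_vector_derivative_diff[OF dv'
              has_vector_derivative_const], of h]
        show ?thesis by (simp add: nv_rt del: matrix_linear(2))
      qed
      ultimately show ?thesis
        unfolding zero_prod_def by (intro has_vector_derivative_Pair)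
    qed
    from const[OF this]
    have "(0, h, 0) \<odot> ((0, 0, - (\<beta> * r)) \<odot> ((0, - h, 0) \<odot> \<gamma> r))
       = (0, h, 0) \<odot> ((0, 0, - (\<beta> * s)) \<odot> ((0, - h, 0) \<odot> \<gamma> s))"
      by (simp add: \<gamma>)
    then show ?thesis by (simp add: transversal(3) m_assoc del: mul_osc)
  qed
  then have "\<gamma> r = osc_exp A r \<odot> (osc_exp A (- s) \<odot> \<gamma> s)"
    using mul_cancel(6)[of "osc_exp A r" "\<gamma> r"] by (simp add: osc_exp_minus[OF A, of r])
  then show ?thesis
    using osc_exp_add[OF A, of r "- s"] by (simp add: m_assoc)
qed

end

section \<open>The quotient\<close>

locale osc_discrete = oscillator lam for lam :: "'n::finite \<Rightarrow> real" +
  fixes \<Gamma> :: "'n osc set"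
  assumes subgroup: "subgroup \<Gamma> (osc_group lam)" and discrete: "discrete \<Gamma>"
begin

abbreviation pr :: "'n osc \<Rightarrow> 'n osc set" where "pr \<equiv> osc_proj lam \<Gamma>"

lemma Gamma_one [simp]: "(0, 0, 0) \<in> \<Gamma>"
  using subgroup.one_closed[OF subgroup] by simp

lemma Gamma_mul: "x \<in> \<Gamma> \<Longrightarrow> y \<in> \<Gamma> \<Longrightarrow> x \<odot> y \<in> \<Gamma>"
  using subgroup.m_closed[OF subgroup] .

lemma Gamma_iv: "x \<in> \<Gamma> \<Longrightarrow> iv x \<in> \<Gamma>"
  using subgroup.m_inv_closed[OF subgroup] .

lemma pr_image: "pr g = (\<lambda>k. g \<odot> k) ` \<Gamma>"
  by (auto simp: osc_proj_def l_coset_def)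

lemma mem_pr_iff: "x \<in> pr g \<longleftrightarrow> iv g \<odot> x \<in> \<Gamma>"
proof
  assume "iv g \<odot> x \<in> \<Gamma>"
  then show "x \<in> pr g" unfolding pr_image by (rule rev_image_eqI) simp
qed (auto simp: pr_image)

lemma pr_eq_iff: "pr g = pr h \<longleftrightarrow> iv g \<odot> h \<in> \<Gamma>"
proof
  show "iv g \<odot> h \<in> \<Gamma>" if "pr g = pr h"
    using that by (simp flip: mem_pr_iff) (simp add: mem_pr_iff)
  assume gh: "iv g \<odot> h \<in> \<Gamma>"
  have "iv h \<odot> x = iv (iv g \<odot> h) \<odot> (iv g \<odot> x)" "iv g \<odot> x = (iv g \<odot> h) \<odot> (iv h \<odot> x)" for x
    by (simp_all add: inv_mult_group m_assoc)
  then have "iv h \<odot> x \<in> \<Gamma> \<longleftrightarrow> iv g \<odot> x \<in> \<Gamma>" for x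
    using Gamma_mul Gamma_iv gh by metis
  then show "pr g = pr h" by (auto simp: mem_pr_iff)
qed

lemma pr_mul_Gamma: "k \<in> \<Gamma> \<Longrightarrow> pr (g \<odot> k) = pr g"
  using pr_eq_iff[of g "g \<odot> k"] by simp

lemma image_pr: "(\<lambda>x. g \<odot> x) ` pr h = pr (g \<odot> h)"
  by (auto simp: pr_image image_image m_assoc)

lemma osc_quot_pr: "osc_quot lam \<Gamma> = range pr"
  by (auto simp: osc_quot_def LCOSETS_def osc_proj_def)

text \<open>Stated for an arbitrary filter because it is applied both to neighbourhoods of a
  parameter, when lifts are compared, and to sequences in \<Gamma>.\<close>

lemma discrete_eventually_const:
  assumes "\<forall>\<^sub>F x in F. k x \<in> \<Gamma>" "(k \<longlongrightarrow> a) F" "a \<in> \<Gamma>"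
  shows "\<forall>\<^sub>F x in F. k x = a"
proof -
  obtain T where T: "open T" "T \<inter> \<Gamma> = {a}"
    using discrete assms(3) unfolding discrete_def isolated_in_def by metis
  then have "\<forall>\<^sub>F x in F. k x \<in> T" using topological_tendstoD[OF assms(2)] by blast
  with assms(1) show ?thesis by eventually_elim (use T in blast)
qed

text \<open>The quotient of the two lifts takes values in \<Gamma> near \<open>s\<close> and is
  continuous at \<open>s\<close>; discreteness makes it constant near \<open>s\<close>.\<close>

lemma lifts_differ_by_Gamma:
  assumes eq: "\<forall>\<^sub>F r in nhds s. pr (\<gamma>1 r) = pr (\<gamma>2 r)" and "isCont \<gamma>1 s" "isCont \<gamma>2 s"
  obtains k where "k \<in> \<Gamma>" "\<forall>\<^sub>F r in nhds s. \<gamma>2 r = \<gamma>1 r \<odot> k"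
proof -
  let ?k = "\<lambda>r. iv (\<gamma>1 r) \<odot> \<gamma>2 r"
  have k: "\<forall>\<^sub>F r in nhds s. ?k r \<in> \<Gamma>" using eq by (simp add: pr_eq_iff)
  then have ks: "?k s \<in> \<Gamma>" by (rule eventually_nhds_x_imp_x)
  have "(?k \<longlongrightarrow> ?k s) (nhds s)"
    using assms(2,3) by (intro tendsto_mul tendsto_iv) (auto simp: isCont_def tendsto_at_iff_tendsto_nhds)
  from discrete_eventually_const[OF k this ks] have "\<forall>\<^sub>F r in nhds s. \<gamma>2 r = \<gamma>1 r \<odot> ?k s"
    by eventually_elim (metis mul_cancel(6))
  with ks that show thesis by blast
qed


section \<open>Tangent vectors and geodesics of the quotient\<close>

text \<open>The right-invariant fields descend to the quotient and trivialise its tangent bundle: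
  \<open>tv p A\<close> is the tangent vector at \<open>p\<close> with right-invariant components \<open>A\<close>.\<close>

definition tv :: "'n osc set \<Rightarrow> 'n osc \<Rightarrow> ('n osc \<times> 'n osc) set" where
  "tv p A = (\<lambda>x. (x, RF A x)) ` p"

lemma proj_diff_RF: "proj_diff lam \<Gamma> g (RF A g) = tv (pr g) A"
  by (simp add: proj_diff_def tv_def pr_image image_image right_diff_RF)

lemma tv_inject: "tv (pr g) A = tv (pr h) B \<longleftrightarrow> pr g = pr h \<and> A = B"
proof
  assume eq: "tv (pr g) A = tv (pr h) B"
  have "fst ` tv p A = p" for p A by (simp add: tv_def image_image)
  with eq have "pr g = pr h" by metis
  moreover have "(g, RF A g) \<in> tv (pr g) A"
    unfolding tv_def by (rule imageI) (simp add: mem_pr_iff)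
  then have "(g, RF A g) \<in> tv (pr h) B" unfolding eq .
  then have "A = B" by (auto simp: tv_def dest: RF_inj)
  ultimately show "pr g = pr h \<and> A = B" ..
qed simp

text \<open>The definite description is legitimate: every pair of lifts has the same right-invariant
  components, and by \<open>metric_RF\<close> the metric depends only on these.\<close>

lemma quot_metric_tv: "quot_metric lam \<Gamma> (tv (pr g) A) (tv (pr g) B) = osc_form lam A B"
  unfolding quot_metric_def
proof (rule the_equality)
  show "\<exists>h u w. tv (pr g) A = proj_diff lam \<Gamma> h u \<and> tv (pr g) B = proj_diff lam \<Gamma> h w \<and>
      osc_form lam A B = osc_metric lam h u w"
    by (rule exI[of _ g], rule exI[of _ "RF A g"], rule exI[of _ "RF B g"])
      (simp add: proj_diff_RF metric_RF)
  fix r assume "\<exists>h u w. tv (pr g) A = proj_diff lam \<Gamma> h u \<and> tv (pr g) B = proj_diff lam \<Gamma> h w \<and>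
      r = osc_metric lam h u w"
  then obtain h u w where h: "tv (pr g) A = proj_diff lam \<Gamma> h u" "tv (pr g) B = proj_diff lam \<Gamma> h w"
    and r: "r = osc_metric lam h u w" by blast
  obtain A' B' where "u = RF A' h" "w = RF B' h" using RF_surj by metis
  with h r show "r = osc_form lam A B" by (simp add: proj_diff_RF tv_inject metric_RF)
qed

lemma has_vector_derivative_mul_right:
  assumes "(\<gamma> has_vector_derivative RF A (\<gamma> s)) (at s)"
  shows "((\<lambda>r. \<gamma> r \<odot> k) has_vector_derivative RF A (\<gamma> s \<odot> k)) (at s)"
proof -
  have "((\<lambda>x. x \<odot> k) has_derivative right_diff lam k (\<gamma> s)) (at (\<gamma> s))"
    unfolding right_diff_def
    using has_derivative_mul[OF has_derivative_ident has_derivative_const]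
    by (intro frechet_derivative_works[THEN iffD1] differentiableI)
  then have "((\<lambda>x. x \<odot> k) has_derivative right_diff lam k (\<gamma> s)) (at (\<gamma> s) within range \<gamma>)"
    by (rule has_derivative_at_withinI)
  from vector_derivative_diff_chain_within[OF assms this] show ?thesis
    by (simp add: o_def right_diff_RF)
qed

section \<open>Velocities of curves in the quotient\<close>

lemma has_velocityI:
  assumes "\<forall>\<^sub>F r in nhds s. c r = pr (\<gamma> r)" "(\<gamma> has_vector_derivative RF A (\<gamma> s)) (at s)"
  shows "has_velocity lam \<Gamma> c s (tv (c s) A)"
  unfolding has_velocity_def eventually_nhds_x_imp_x[OF assms(1)] proj_diff_RF[symmetric]
  using assms by blast

lemma has_velocityE:
  assumes "has_velocity lam \<Gamma> c s X"
  obtains \<gamma> A where "\<forall>\<^sub>F r in nhds s. c r = pr (\<gamma> r)"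
    "(\<gamma> has_vector_derivative RF A (\<gamma> s)) (at s)" "X = tv (c s) A"
proof -
  obtain \<gamma> u where *: "\<forall>\<^sub>F r in nhds s. c r = pr (\<gamma> r)" "(\<gamma> has_vector_derivative u) (at s)"
    "X = proj_diff lam \<Gamma> (\<gamma> s) u" using assms unfolding has_velocity_def by blast
  obtain A where "u = RF A (\<gamma> s)" using RF_surj by metis
  with * eventually_nhds_x_imp_x[OF *(1)] that[of \<gamma> A] show thesis
    by (simp add: proj_diff_RF)
qed

text \<open>Two lifts differ near \<open>s\<close> by a right factor from \<Gamma>, which leaves the
  right-invariant components of the derivative unchanged.\<close>

lemma has_velocity_unique:
  assumes "has_velocity lam \<Gamma> c s X" "has_velocity lam \<Gamma> c s Y"
  shows "X = Y"
proof -
  obtain \<gamma>1 A where 1: "\<forall>\<^sub>F r in nhds s. c r = pr (\<gamma>1 r)"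
    "(\<gamma>1 has_vector_derivative RF A (\<gamma>1 s)) (at s)" "X = tv (c s) A"
    using assms(1) by (rule has_velocityE)
  obtain \<gamma>2 B where 2: "\<forall>\<^sub>F r in nhds s. c r = pr (\<gamma>2 r)"
    "(\<gamma>2 has_vector_derivative RF B (\<gamma>2 s)) (at s)" "Y = tv (c s) B"
    using assms(2) by (rule has_velocityE)
  have "\<forall>\<^sub>F r in nhds s. pr (\<gamma>1 r) = pr (\<gamma>2 r)" using 1(1) 2(1) by eventually_elim simp
  then obtain k where k: "\<forall>\<^sub>F r in nhds s. \<gamma>2 r = \<gamma>1 r \<odot> k"
    using lifts_differ_by_Gamma[of \<gamma>1 \<gamma>2 s] has_vector_derivative_continuous[OF 1(2)]
      has_vector_derivative_continuous[OF 2(2)] by metis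
  have ks: "\<gamma>2 s = \<gamma>1 s \<odot> k" using k by (rule eventually_nhds_x_imp_x)
  have "(\<gamma>2 has_vector_derivative RF A (\<gamma>2 s)) (at s)"
  proof -
    have "\<forall>\<^sub>F r in nhds s. r \<in> UNIV \<longrightarrow> \<gamma>1 r \<odot> k = \<gamma>2 r" using k by eventually_elim simp
    from has_vector_derivative_cong_ev[OF this ks[symmetric]] show ?thesis
      using has_vector_derivative_mul_right[OF 1(2), of k] by (simp add: ks)
  qed
  then have "RF A (\<gamma>2 s) = RF B (\<gamma>2 s)" using 2(2) by (rule vector_derivative_unique_at)
  with 1(3) 2(3) show ?thesis by (auto dest: RF_inj)
qed

section \<open>Classification of the lightlike geodesics of the quotient\<close>

lemma has_velocity_flow:
  assumes A: "osc_form lam A A = 0" and c: "\<forall>\<^sub>F r in nhds s. c r = pr (osc_exp A r \<odot> g)"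
  shows "has_velocity lam \<Gamma> c s (tv (c s) A)"
  using has_velocityI[OF c osc_exp_deriv[OF A]] .

lemma quot_geodesic_on_flow:
  assumes A: "osc_form lam A A = 0"
  shows "quot_geodesic_on lam \<Gamma> UNIV (\<lambda>s. pr (osc_exp A s \<odot> g))"
  unfolding quot_geodesic_on_def
  using geodesic_on_RF[OF osc_exp_deriv[OF A], of UNIV g] is_interval_univ by blast

lemma lightlike_geodesic_flow:
  assumes A: "osc_form lam A A = 0"
  shows "lightlike_geodesic lam \<Gamma> UNIV (\<lambda>s. pr (osc_exp A s \<odot> g))"
proof -
  have "has_velocity lam \<Gamma> (\<lambda>s. pr (osc_exp A s \<odot> g)) s (tv (pr (osc_exp A s \<odot> g)) A)" for s
    using has_velocity_flow[OF A, of "\<lambda>s. pr (osc_exp A s \<odot> g)" g s] by simp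
  then show ?thesis
    unfolding lightlike_geodesic_def maximal_geodesic_def
    using quot_geodesic_on_flow[OF A, of g] by (metis quot_metric_tv A UNIV_I top.extremum_uniqueI)
qed

lemma lightlike_geodesic_local:
  assumes geo: "quot_geodesic_on lam \<Gamma> I c" and s: "s \<in> I"
    and null: "has_velocity lam \<Gamma> c s X" "quot_metric lam \<Gamma> X X = 0"
  obtains A g where "osc_form lam A A = 0" "\<forall>\<^sub>F r in nhds s. c r = pr (osc_exp A r \<odot> g)"
proof -
  obtain J \<gamma> where J: "open J" "s \<in> J" and \<gamma>: "geodesic_on (osc_metric lam) J \<gamma>"
    and c: "\<And>r. r \<in> J \<Longrightarrow> c r = pr (\<gamma> r)"
    using geo s unfolding quot_geodesic_on_def by metis
  obtain e where e: "e > 0" "ball s e \<subseteq> J" using J openE by blast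
  have "geodesic_on (osc_metric lam) (ball s e) \<gamma>"
    using \<gamma> e(2) unfolding geodesic_on_def by blast
  then obtain A where A: "\<And>r. r \<in> ball s e \<Longrightarrow> (\<gamma> has_vector_derivative RF A (\<gamma> r)) (at r)"
    by (rule geodesic_on_imp_RF) auto
  have ev: "\<forall>\<^sub>F r in nhds s. r \<in> ball s e" using e by (intro eventually_nhds_in_open) auto
  then have "\<forall>\<^sub>F r in nhds s. c r = pr (\<gamma> r)" by eventually_elim (use e c in blast)
  then have "has_velocity lam \<Gamma> c s (tv (c s) A)"
    by (rule has_velocityI) (use A[of s] e in auto)
  then have "X = tv (pr (\<gamma> s)) A" using has_velocity_unique null(1) c J by metis
  then have ll: "osc_form lam A A = 0" using null(2) by (simp add: quot_metric_tv)
  \<comment> \<open>Absorbing the base time \<open>s\<close> into the starting point removes it from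
    the flow parameter, so that descriptions at different times can be compared.\<close>
  have flow: "\<gamma> r = osc_exp A r \<odot> (osc_exp A (- s) \<odot> \<gamma> s)" if "r \<in> ball s e" for r
    using osc_exp_flow[OF ll convex_ball A that, of s] e osc_exp_add[OF ll, of r "- s"]
    by (simp add: m_assoc)
  have "\<forall>\<^sub>F r in nhds s. c r = pr (osc_exp A r \<odot> (osc_exp A (- s) \<odot> \<gamma> s))"
    using ev
  proof eventually_elim
    case (elim r)
    then have "c r = pr (\<gamma> r)" using c e(2) by blast
    then show ?case unfolding flow[OF elim] .
  qed
  with ll that show thesis by blast
qed

text \<open>The local data, \<open>A s\<close> and the coset of \<open>g s\<close>, are locally
  constant, hence constant on the connected domain. The resulting flow curve extends
  \<open>c\<close> to the whole line, and maximality gives \<open>I = UNIV\<close>.\<close>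

lemma lightlike_geodesic_imp_flow:
  assumes "lightlike_geodesic lam \<Gamma> I c"
  obtains A g where "I = UNIV" "osc_form lam A A = 0" "c = (\<lambda>s. pr (osc_exp A s \<odot> g))"
proof -
  have max: "maximal_geodesic lam \<Gamma> I c" and geo: "quot_geodesic_on lam \<Gamma> I c"
    and null: "\<And>s. s \<in> I \<Longrightarrow> \<exists>X. has_velocity lam \<Gamma> c s X \<and> quot_metric lam \<Gamma> X X = 0"
    using assms unfolding lightlike_geodesic_def maximal_geodesic_def by blast+
  have I: "open I" "connected I" "I \<noteq> {}"
    using geo unfolding quot_geodesic_on_def by (auto simp: is_interval_connected)
  have "\<forall>s\<in>I. \<exists>A g. osc_form lam A A = 0 \<and> (\<forall>\<^sub>F r in nhds s. c r = pr (osc_exp A r \<odot> g))"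
  proof
    fix s assume s: "s \<in> I"
    obtain X where "has_velocity lam \<Gamma> c s X" "quot_metric lam \<Gamma> X X = 0" using null[OF s] by blast
    then show "\<exists>A g. osc_form lam A A = 0 \<and> (\<forall>\<^sub>F r in nhds s. c r = pr (osc_exp A r \<odot> g))"
      by (rule lightlike_geodesic_local[OF geo s]) blast
  qed
  from bchoice[OF this] obtain A
    where Ag: "\<forall>s\<in>I. \<exists>g. osc_form lam (A s) (A s) = 0 \<and>
      (\<forall>\<^sub>F r in nhds s. c r = pr (osc_exp (A s) r \<odot> g))" by blast
  from bchoice[OF this] obtain g
    where g: "\<forall>s\<in>I. osc_form lam (A s) (A s) = 0 \<and>
      (\<forall>\<^sub>F r in nhds s. c r = pr (osc_exp (A s) r \<odot> g s))" by blast
  have A: "osc_form lam (A s) (A s) = 0"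
    and c: "\<forall>\<^sub>F r in nhds s. c r = pr (osc_exp (A s) r \<odot> g s)" if "s \<in> I" for s
    using g that by blast+
  have loc: "\<forall>\<^sub>F r in nhds s. A r = A s \<and> pr (g r) = pr (g s)" if s: "s \<in> I" for s
  proof -
    have "\<forall>\<^sub>F r in nhds s. r \<in> I" using I s by (intro eventually_nhds_in_open) auto
    moreover have "\<forall>\<^sub>F r in nhds s. \<forall>\<^sub>F r' in nhds r. c r' = pr (osc_exp (A s) r' \<odot> g s)"
      using c[OF s] by (simp add: eventually_eventually)
    ultimately show ?thesis
    proof eventually_elim
      case (elim r)
      have cr: "c r = pr (osc_exp (A s) r \<odot> g s)" "c r = pr (osc_exp (A r) r \<odot> g r)"
        using elim c[of r] eventually_nhds_x_imp_x by force+
      have "tv (c r) (A r) = tv (c r) (A s)"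
        using has_velocity_unique[OF has_velocity_flow[OF A c] has_velocity_flow[OF A elim(2)]]
          elim(1) s by blast
      then have Ar: "A r = A s" unfolding cr(1) tv_inject by simp
      \<comment> \<open>Left translation acts on cosets (\<open>image_pr\<close>), so the common
        flow factor can be cancelled.\<close>
      have "pr (osc_exp (A s) (- r) \<odot> (osc_exp (A s) r \<odot> g r))
          = pr (osc_exp (A s) (- r) \<odot> (osc_exp (A s) r \<odot> g s))"
        using cr unfolding Ar by (simp flip: image_pr)
      then have "pr (g r) = pr (g s)" by (simp add: osc_exp_minus[OF A[OF s]])
      with Ar show ?case ..
    qed
  qed
  obtain s0 where s0: "s0 \<in> I" using I(3) by blast
  have at: "\<forall>\<^sub>F r in at s within I. A s = A r \<and> pr (g s) = pr (g r)" if "s \<in> I" for s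
    unfolding eventually_at_filter by (rule eventually_mono[OF loc[OF that]]) auto
  have AI: "A s = A s0" if "s \<in> I" for s
    by (rule connected_local_const[OF I(2) that s0]) (auto elim: eventually_mono[OF at])
  have gI: "pr (g s) = pr (g s0)" if "s \<in> I" for s
    by (rule connected_local_const[OF I(2) that s0]) (auto elim: eventually_mono[OF at])
  have cI: "pr (osc_exp (A s0) s \<odot> g s0) = c s" if s: "s \<in> I" for s
    using eventually_nhds_x_imp_x[OF c[OF s]] AI[OF s] gI[OF s] by (metis image_pr)
  have "I = UNIV"
    using max quot_geodesic_on_flow[OF A[OF s0], of "g s0"] cI
    unfolding maximal_geodesic_def by blast
  with cI A[OF s0] that[of "A s0" "g s0"] show thesis by (simp add: fun_eq_iff)
qed

text \<open>The one-parameter group law makes the period condition at \<open>s\<close> independent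
  of \<open>s\<close>: the quotient of the two points is the inverse of the conjugate of
  \<open>osc_exp A T\<close>.\<close>

lemma closed_geodesic_flow_iff:
  assumes A: "osc_form lam A A = 0"
  shows "closed_geodesic UNIV (\<lambda>s. pr (osc_exp A s \<odot> g))
     \<longleftrightarrow> (\<exists>T>0. iv g \<odot> (osc_exp A T \<odot> g) \<in> \<Gamma>)"
proof -
  have "iv (osc_exp A (s + T) \<odot> g) \<odot> (osc_exp A s \<odot> g) = iv (iv g \<odot> (osc_exp A T \<odot> g))" for s T
    by (simp add: osc_exp_add[OF A] inv_mult_group m_assoc)
  moreover have "iv x \<in> \<Gamma> \<longleftrightarrow> x \<in> \<Gamma>" for x
    using Gamma_iv[of x] Gamma_iv[of "iv x"] by auto
  ultimately have "pr (osc_exp A (s + T) \<odot> g) = pr (osc_exp A s \<odot> g)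
      \<longleftrightarrow> iv g \<odot> (osc_exp A T \<odot> g) \<in> \<Gamma>" for s T
    by (simp add: pr_eq_iff)
  then show ?thesis by (simp add: closed_geodesic_def)
qed


section \<open>Lightlike directions\<close>

lemma RF_scaleR: "RF (r *\<^sub>R A) g = r *\<^sub>R RF A g"
  by (cases A; cases g) (simp add: algebra_simps)

lemma proj_diff_span: "proj_diff lam \<Gamma> g ` span {RF A g} = tv (pr g) ` span {A}"
  unfolding span_singleton image_image RF_scaleR[symmetric] proj_diff_RF
  by (simp add: image_def)

lemma osc_form_scaleR: "osc_form lam (r *\<^sub>R A) (r *\<^sub>R A) = r\<^sup>2 * osc_form lam A A"
  by (cases A) (simp add: osc_form_qf power2_eq_square algebra_simps del: osc_form.simps)

text \<open>Right-invariant components identify the tangent space at \<open>p\<close> with the Lie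
  algebra independently of the representative \<open>g\<close>, so directions at \<open>p\<close>
  become null lines spanned by some \<open>A\<close>.\<close>

lemma lightlike_direction_iff:
  assumes p: "p \<in> osc_quot lam \<Gamma>"
  shows "lightlike_direction lam \<Gamma> p D \<longleftrightarrow>
    (\<exists>A. A \<noteq> 0 \<and> osc_form lam A A = 0 \<and> D = tv p ` span {A})"
proof
  obtain g0 where g0: "p = pr g0" using p osc_quot_pr by auto
  have g: "pr g = p" if "g \<in> p" for g
    using that unfolding g0 by (metis mem_pr_iff pr_eq_iff)
  {
    assume "lightlike_direction lam \<Gamma> p D"
    then obtain g S where S: "g \<in> p" "subspace S" "dim S = 1" "D = proj_diff lam \<Gamma> g ` S"
      and null: "\<And>X. X \<in> D \<Longrightarrow> quot_metric lam \<Gamma> X X = 0"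
      unfolding lightlike_direction_def by blast
    obtain B where B: "B \<subseteq> S" "independent B" "S \<subseteq> span B" "card B = dim S"
      using basis_exists by blast
    then obtain u where u: "B = {u}" using S(3) by (auto simp: card_1_singleton_iff)
    have Su: "S = span {u}" using B S(2) unfolding u by (simp add: span_subspace)
    have "u \<noteq> 0" using B(2) u by auto
    obtain A where A: "u = RF A g" using RF_surj by metis
    have "A \<noteq> 0" using \<open>u \<noteq> 0\<close> A RF_scaleR[of 0 A g] by auto
    moreover have D: "D = tv p ` span {A}"
      unfolding S(4) Su A proj_diff_span g[OF S(1)] ..
    moreover have "osc_form lam A A = 0"
      using null[of "tv p A"] unfolding D g0 quot_metric_tv by (simp add: span_base)
    ultimately show "\<exists>A. A \<noteq> 0 \<and> osc_form lam A A = 0 \<and> D = tv p ` span {A}" by blast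
  next
    assume "\<exists>A. A \<noteq> 0 \<and> osc_form lam A A = 0 \<and> D = tv p ` span {A}"
    then obtain A where A: "A \<noteq> 0" "osc_form lam A A = 0" "D = tv p ` span {A}" by blast
    have "RF A g0 \<noteq> 0" using A(1) RF_inj[of A g0 0] RF_scaleR[of 0 A g0] by auto
    then have "dim (span {RF A g0}) = 1" by simp
    moreover have "D = proj_diff lam \<Gamma> g0 ` span {RF A g0}"
      using A(3) by (simp add: proj_diff_span g0)
    moreover have "g0 \<in> p" by (simp add: g0 mem_pr_iff)
    moreover have "quot_metric lam \<Gamma> X X = 0" if "X \<in> D" for X
      using that unfolding A(3) g0 by (auto simp: span_singleton quot_metric_tv osc_form_scaleR A(2))
    ultimately show "lightlike_direction lam \<Gamma> p D"
      unfolding lightlike_direction_def using subspace_span by blast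
  }
qed

lemma Z_direction_eq:
  assumes p: "p \<in> osc_quot lam \<Gamma>"
  shows "Z_direction lam \<Gamma> p = tv p ` span {osc_Z}"
proof -
  obtain g0 where g0: "p = pr g0" using p osc_quot_pr by auto
  have g: "pr g = p" if "g \<in> p" for g
    using that unfolding g0 by (metis mem_pr_iff pr_eq_iff)
  \<comment> \<open>Both fields have the constant coordinates \<open>(1, 0, 0)\<close>, as Z is
    central.\<close>
  have "left_inv_field lam osc_Z g = RF osc_Z g" for g
    unfolding left_inv_field_def osc_Z_def by (cases g) (simp add: left_diff_osc)
  moreover have "p \<noteq> {}" by (simp add: g0 pr_image) (metis Gamma_one empty_iff)
  ultimately show ?thesis
    unfolding Z_direction_def using g by (auto simp: proj_diff_span)
qed

text \<open>By uniqueness of velocities the generator of the flow curve is a multiple of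
  \<open>A\<close>; the multiple is nonzero because the initial velocity has to span the
  direction.\<close>

lemma lightlike_geodesic_in_direction_iff:
  assumes p: "p \<in> osc_quot lam \<Gamma>" and A: "A \<noteq> 0" "osc_form lam A A = 0"
  shows "lightlike_geodesic_in_direction lam \<Gamma> p (tv p ` span {A}) I c \<longleftrightarrow>
    I = UNIV \<and> (\<exists>r g. r \<noteq> 0 \<and> pr g = p \<and> c = (\<lambda>s. pr (osc_exp (r *\<^sub>R A) s \<odot> g)))"
proof
  obtain g0 where g0: "p = pr g0" using p osc_quot_pr by auto
  have RF0: "RF 0 g = 0" for g using RF_scaleR[of 0 0 g] by simp
  have zero: "proj_diff lam \<Gamma> g 0 = tv (pr g) 0" for g
    using proj_diff_RF[of g 0] by (simp add: RF0)
  {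
    assume "lightlike_geodesic_in_direction lam \<Gamma> p (tv p ` span {A}) I c"
    then obtain X where ll: "lightlike_geodesic lam \<Gamma> I c" and c0: "c 0 = p"
      and X: "X \<in> tv p ` span {A}" "has_velocity lam \<Gamma> c 0 X" "\<And>g. X \<noteq> proj_diff lam \<Gamma> g 0"
      unfolding lightlike_geodesic_in_direction_def by blast
    from ll obtain B g where I: "I = UNIV" and B: "osc_form lam B B = 0"
      and c: "c = (\<lambda>s. pr (osc_exp B s \<odot> g))" by (rule lightlike_geodesic_imp_flow)
    have pg: "pr g = p" using c0 B by (simp add: c)
    have "has_velocity lam \<Gamma> c 0 (tv p B)"
      using has_velocity_flow[OF B, of c g 0] c0 c by simp
    with X(2) have "X = tv p B" by (rule has_velocity_unique)
    moreover from X(1) obtain r where "X = tv p (r *\<^sub>R A)" by (auto simp: span_singleton)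
    ultimately have "B = r *\<^sub>R A" unfolding g0 by (simp add: tv_inject)
    moreover have "r \<noteq> 0" using X(3)[of g0] \<open>X = tv p B\<close> \<open>B = r *\<^sub>R A\<close> by (auto simp: zero g0)
    ultimately show "I = UNIV \<and> (\<exists>r g. r \<noteq> 0 \<and> pr g = p \<and> c = (\<lambda>s. pr (osc_exp (r *\<^sub>R A) s \<odot> g)))"
      using I c pg by blast
  next
    assume "I = UNIV \<and> (\<exists>r g. r \<noteq> 0 \<and> pr g = p \<and> c = (\<lambda>s. pr (osc_exp (r *\<^sub>R A) s \<odot> g)))"
    then obtain r g where I: "I = UNIV" and r: "r \<noteq> 0" and pg: "pr g = p"
      and c: "c = (\<lambda>s. pr (osc_exp (r *\<^sub>R A) s \<odot> g))" by blast
    have B: "osc_form lam (r *\<^sub>R A) (r *\<^sub>R A) = 0" by (simp add: osc_form_scaleR A(2))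
    have c0: "c 0 = p" using B pg by (simp add: c)
    have "has_velocity lam \<Gamma> c 0 (tv p (r *\<^sub>R A))"
      using has_velocity_flow[OF B, of c g 0] c0 c by simp
    moreover have "tv p (r *\<^sub>R A) \<in> tv p ` span {A}"
      by (intro imageI span_scale span_base) simp
    moreover have "tv p (r *\<^sub>R A) \<noteq> proj_diff lam \<Gamma> h 0" for h
      using r A(1) by (simp add: zero g0 tv_inject)
    ultimately show "lightlike_geodesic_in_direction lam \<Gamma> p (tv p ` span {A}) I c"
      unfolding lightlike_geodesic_in_direction_def
      using lightlike_geodesic_flow[OF B, of g] c0 I c by blast
  }
qed

end

section \<open>Lattices\<close>

lemma cmod_blk_le: "cmod (blk v i) \<le> 2 * norm v"
  using cmod_le[of "blk v i"] component_le_norm_cart[of v "(i, 1)"] component_le_norm_cart[of v "(i, 2)"]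
  by simp

lemma norm_le_blk: "norm v \<le> (\<Sum>i\<in>UNIV. 2 * cmod (blk v i))"
proof -
  have "norm v \<le> (\<Sum>i\<in>UNIV. \<bar>v $ (i, 1)\<bar> + \<bar>v $ (i, 2)\<bar>)"
    using norm_le_l1_cart[of v] unfolding sum_blocks .
  also have "\<dots> \<le> (\<Sum>i\<in>UNIV. 2 * cmod (blk v i))"
    using abs_Re_le_cmod[of "blk v _"] abs_Im_le_cmod[of "blk v _"]
    by (intro sum_mono) (smt (verit) Re_blk Im_blk)
  finally show ?thesis .
qed

lemma norm_osc_components_le: "norm v \<le> norm (z, v, t)" "\<bar>t\<bar> \<le> norm (z, v, t)"
  using norm_snd_le[where x=z and y="(v, t)"] norm_fst_le[where x=v and y=t]
    norm_snd_le[where x=v and y=t] by (simp_all only: real_norm_def order_trans)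

locale osc_lattice = osc_discrete lam \<Gamma> for lam :: "'n::finite \<Rightarrow> real" and \<Gamma> +
  assumes cocompact: "compact_space (quot_topology lam \<Gamma>)"
begin

lemma bounded_translate:
  assumes "bounded K"
  shows "bounded ((\<lambda>x. g \<odot> (x \<odot> h)) ` K)"
proof -
  have "continuous_on (closure K) (\<lambda>x. g \<odot> (x \<odot> h))"
    unfolding continuous_on_def by (intro ballI tendsto_intros)
  then have "bounded ((\<lambda>x. g \<odot> (x \<odot> h)) ` closure K)"
    using assms by (intro compact_imp_bounded compact_continuous_image) (simp_all add: compact_closure)
  then show ?thesis by (rule bounded_subset) (use closure_subset in blast)
qed

text \<open>The images of the balls around the origin form an open cover of the compact quotient;
  finitely many of these balls together are the bounded set.\<close>

lemma bounded_fundamental_set: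
  obtains K where "bounded K" "\<forall>x. \<exists>k\<in>K. \<exists>\<eta>\<in>\<Gamma>. x = k \<odot> \<eta>"
proof -
  define U where "U n = pr ` ball 0 (real n)" for n
  have "openin (quot_topology lam \<Gamma>) (U n)" for n
  proof -
    \<comment> \<open>The preimage of the image of a ball is the union of its right translates by
      \<Gamma>, which shows that it is open.\<close>
    have "{g. pr g \<in> U n} = (\<Union>k\<in>\<Gamma>. (\<lambda>g. g \<odot> k) -` ball 0 (real n))" (is "?L = ?R")
    proof (intro subset_antisym subsetI)
      fix g assume "g \<in> ?L"
      then obtain h where "h \<in> ball 0 (real n)" "pr g = pr h" by (auto simp: U_def)
      then have "iv g \<odot> h \<in> \<Gamma>" "g \<in> (\<lambda>g. g \<odot> (iv g \<odot> h)) -` ball 0 (real n)"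
        by (simp_all add: pr_eq_iff)
      then show "g \<in> ?R" by blast
    next
      fix g assume "g \<in> ?R"
      then obtain k where k: "k \<in> \<Gamma>" "g \<odot> k \<in> ball 0 (real n)" by blast
      then show "g \<in> ?L" using pr_mul_Gamma[OF k(1), of g] by (auto simp: U_def)
    qed
    moreover have "open ((\<lambda>g. g \<odot> k) -` ball 0 (real n))" for k
      by (intro open_vimage open_ball) (auto simp: continuous_on_def intro!: tendsto_intros)
    ultimately show ?thesis
      unfolding openin_quot_topology by (auto simp: U_def osc_quot_pr)
  qed
  moreover have top: "topspace (quot_topology lam \<Gamma>) = range pr"
    using quotient_map_proj[of lam \<Gamma>] by (simp add: quotient_map_def)
  moreover have "range pr \<subseteq> \<Union> (range U)"
    using reals_Archimedean2[of "norm _"] by (fastforce simp: U_def)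
  ultimately have "\<exists>\<F>. finite \<F> \<and> \<F> \<subseteq> range U \<and> range pr \<subseteq> \<Union> \<F>"
    using compactinD[OF cocompact[unfolded compact_space_def], of "range U"] by auto
  then obtain \<F> where \<F>: "finite \<F>" "\<F> \<subseteq> range U" "range pr \<subseteq> \<Union> \<F>" by blast
  then obtain N where N: "finite N" "\<F> = U ` N" by (metis finite_subset_image)
  show thesis
  proof
    show "bounded (\<Union>n\<in>N. ball 0 (real n) :: 'n osc set)" using N(1) by auto
    show "\<forall>x. \<exists>k\<in>\<Union>n\<in>N. ball 0 (real n). \<exists>\<eta>\<in>\<Gamma>. x = k \<odot> \<eta>"
    proof
      fix x
      obtain n where n: "n \<in> N" "pr x \<in> U n" using \<F>(3) N(2) by blast
      then obtain k where k: "k \<in> ball 0 (real n)" "pr k = pr x" unfolding U_def by (metis imageE)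
      have "iv k \<odot> x \<in> \<Gamma>" "x = k \<odot> (iv k \<odot> x)" using k(2) by (simp_all add: pr_eq_iff)
      with n k(1) show "\<exists>k\<in>\<Union>n\<in>N. ball 0 (real n). \<exists>\<eta>\<in>\<Gamma>. x = k \<odot> \<eta>" by blast
    qed
  qed
qed

text \<open>Bolzano-Weierstrass. The limit of the subsequence is not known to lie in \<Gamma>, so
  discreteness is applied to quotients of successive terms, which converge to the identity.\<close>

lemma finite_Gamma_bounded:
  assumes "bounded S"
  shows "finite (\<Gamma> \<inter> S)"
proof (rule ccontr)
  assume "infinite (\<Gamma> \<inter> S)"
  then obtain f :: "nat \<Rightarrow> 'n osc" where f: "inj f" "range f \<subseteq> \<Gamma> \<inter> S"
    using infinite_countable_subset by blast
  have "bounded (range f)" using assms by (rule bounded_subset) (use f in auto)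
  then obtain l r where r: "strict_mono r" and lim: "(\<lambda>n. f (r n)) \<longlonglongrightarrow> l"
    using bounded_imp_convergent_subsequence[of f] by (auto simp: o_def)
  have "(\<lambda>n. iv (f (r n)) \<odot> f (r (Suc n))) \<longlonglongrightarrow> iv l \<odot> l"
    using lim LIMSEQ_Suc[OF lim] by (intro tendsto_intros)
  moreover have "iv (f (r n)) \<odot> f (r (Suc n)) \<in> \<Gamma>" for n
    using f(2) by (intro Gamma_mul Gamma_iv) auto
  ultimately have "\<forall>\<^sub>F n in sequentially. iv (f (r n)) \<odot> f (r (Suc n)) = (0, 0, 0)"
    by (intro discrete_eventually_const) simp_all
  then obtain n where "iv (f (r n)) \<odot> f (r (Suc n)) = (0, 0, 0)"
    unfolding eventually_sequentially by blast
  then have "f (r (Suc n)) = f (r n)" using mul_cancel(6)[of "f (r n)" "f (r (Suc n))"] by simp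
  then have "r (Suc n) = r n" using f(1) by (simp add: inj_eq)
  then show False using r by (simp add: strict_mono_eq)
qed

text \<open>By cocompactness a far point in the direction of block \<open>i\<close> lies within a
  bounded factor of the conjugated lattice, so the i-th blocks occurring there are
  unbounded.\<close>

lemma conj_Gamma_large:
  obtains \<eta> z v t where "\<eta> \<in> \<Gamma>" "iv g \<odot> (\<eta> \<odot> g) = (z, v, t)" "C < cmod (blk v i)"
proof -
  obtain K where K: "bounded K" "\<forall>x. \<exists>k\<in>K. \<exists>\<eta>\<in>\<Gamma>. x = k \<odot> \<eta>"
    by (rule bounded_fundamental_set)
  obtain B where B: "\<And>k. k \<in> K \<Longrightarrow> norm (iv g \<odot> (k \<odot> g)) \<le> B"
    using bounded_translate[OF K(1), of "iv g" g] unfolding bounded_iff by blast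
  \<comment> \<open>The bounded factor contributes at most \<open>2 * B\<close> to the block by
    \<open>cmod_blk_le\<close>; what remains exceeds \<open>C\<close>.\<close>
  define x :: "real ^ ('n \<times> 2)" where "x = axis (i, 1) (\<bar>C\<bar> + 2 * B + 1)"
  obtain k \<eta> where k: "k \<in> K" and \<eta>: "\<eta> \<in> \<Gamma>" and eq: "g \<odot> ((0, x, 0) \<odot> iv g) = k \<odot> \<eta>"
    using K(2) by blast
  obtain a w s where kg: "iv g \<odot> (k \<odot> g) = (a, w, s)" by (metis prod_cases3)
  obtain z v t where \<eta>g: "iv g \<odot> (\<eta> \<odot> g) = (z, v, t)" by (metis prod_cases3)
  have "iv g \<odot> ((g \<odot> ((0, x, 0) \<odot> iv g)) \<odot> g) = (0, x, 0)" by (simp add: m_assoc del: mul_osc)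
  then have "(0, x, 0) = (a, w, s) \<odot> (z, v, t)"
    unfolding eq by (simp add: m_assoc flip: kg \<eta>g)
  then have x: "x = w + rt s v" by simp
  have "cmod (blk w i) \<le> 2 * B"
    using B[OF k] cmod_blk_le[of w i] norm_osc_components_le(1)[of w a s] unfolding kg by linarith
  moreover have "cmod (blk x i) \<le> cmod (blk w i) + cmod (blk v i)"
    unfolding x blk_linear using norm_triangle_ineq[of "blk w i" "blk (rt s v) i"]
    by (simp add: blk_R_mat norm_mult)
  moreover have "blk x i = of_real (\<bar>C\<bar> + 2 * B + 1)"
    by (simp add: x_def complex_eq_iff axis_def)
  then have "cmod (blk x i) \<ge> \<bar>C\<bar> + 2 * B + 1" by (metis abs_ge_self norm_of_real)
  ultimately have "C < cmod (blk v i)" by linarith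
  with \<eta> \<eta>g that show thesis by blast
qed

lemma conj_T_multiple:
  assumes "g \<odot> ((0, 0, \<tau>) \<odot> iv g) \<in> \<Gamma>"
  shows "g \<odot> ((0, 0, real k * \<tau>) \<odot> iv g) \<in> \<Gamma>"
proof (induction k)
  case (Suc k)
  have "g \<odot> ((0, 0, real (Suc k) * \<tau>) \<odot> iv g)
      = g \<odot> (((0, 0, \<tau>) \<odot> (0, 0, real k * \<tau>)) \<odot> iv g)"
    by (simp add: algebra_simps)
  also have "\<dots> = (g \<odot> ((0, 0, \<tau>) \<odot> iv g)) \<odot> (g \<odot> ((0, 0, real k * \<tau>) \<odot> iv g))"
    by (simp add: m_assoc del: mul_osc)
  finally show ?case using Gamma_mul[OF assms Suc] by simp
qed simp

text \<open>For each block take a lattice element whose block is nonzero after conjugation by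
  \<open>g\<close>. Powers of the given element rotate its \<open>v\<close> and fix its
  \<open>z\<close> and \<open>t\<close>, so only finitely many conjugates occur, and two equal ones
  give a period of that block.\<close>

lemma conj_T_finite_order:
  assumes \<tau>: "g \<odot> ((0, 0, \<tau>) \<odot> iv g) \<in> \<Gamma>"
  obtains m where "m > 0" "\<And>v. rt (real m * \<tau>) v = v"
proof -
  have "\<exists>m>0. cis (lam i * (real m * \<tau>)) = 1" for i
  proof -
    obtain \<eta> z v t where \<eta>: "\<eta> \<in> \<Gamma>" "iv g \<odot> (\<eta> \<odot> g) = (z, v, t)" "0 < cmod (blk v i)"
      by (rule conj_Gamma_large)
    define y where "y k = (z, rt (real k * \<tau>) v, t)" for k
    have y: "g \<odot> (y k \<odot> iv g) \<in> \<Gamma>" for k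
    proof -
      let ?c = "g \<odot> ((0, 0, real k * \<tau>) \<odot> iv g)"
      have c: "?c \<in> \<Gamma>" using \<tau> by (rule conj_T_multiple)
      have "y k = (0, 0, real k * \<tau>) \<odot> ((z, v, t) \<odot> iv (0, 0, real k * \<tau>))"
        by (simp add: y_def)
      then have "g \<odot> (y k \<odot> iv g) = ?c \<odot> (\<eta> \<odot> iv ?c)"
        unfolding \<eta>(2)[symmetric] by (simp add: m_assoc inv_mult_group del: mul_osc iv_osc)
      then show ?thesis using Gamma_mul Gamma_iv c \<eta>(1) by simp
    qed
    have "norm (rt s v) \<le> (\<Sum>i\<in>UNIV. 2 * cmod (blk v i))" for s
      using norm_le_blk[of "rt s v"] by (simp add: blk_R_mat norm_mult)
    then have "bounded (range (\<lambda>k. rt (real k * \<tau>) v))" unfolding bounded_iff by blast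
    then have "bounded ({z} \<times> range (\<lambda>k. rt (real k * \<tau>) v) \<times> {t})"
      by (intro bounded_Times) auto
    then have "bounded (range y)" by (rule bounded_subset) (auto simp: y_def)
    from finite_Gamma_bounded[OF bounded_translate[OF this, of g "iv g"]]
    have "finite (range (\<lambda>k. g \<odot> (y k \<odot> iv g)))"
      by (rule rev_finite_subset) (use y in auto)
    then have "\<not> inj (\<lambda>k. g \<odot> (y k \<odot> iv g))" using finite_imageD infinite_UNIV_nat by blast
    then obtain k l where kl: "k < l" "g \<odot> (y k \<odot> iv g) = g \<odot> (y l \<odot> iv g)"
      unfolding inj_def by (metis linorder_neqE_nat)
    then have "y k = y l" by simp
    then have "blk (rt (real k * \<tau>) v) i = blk (rt (real l * \<tau>) v) i" by (simp add: y_def)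
    then have "cis (lam i * (real k * \<tau>)) = cis (lam i * (real l * \<tau>))"
      using \<eta>(3) by (simp add: blk_R_mat)
    then have "cis (lam i * (real l * \<tau>) - lam i * (real k * \<tau>)) = 1"
      by (simp flip: cis_divide)
    moreover have "lam i * (real l * \<tau>) - lam i * (real k * \<tau>) = lam i * (real (l - k) * \<tau>)"
      using kl(1) by (simp add: of_nat_diff algebra_simps)
    ultimately show ?thesis using kl(1) by (intro exI[of _ "l - k"]) simp
  qed
  then obtain m where m: "\<And>i. m i > 0" "\<And>i. cis (lam i * (real (m i) * \<tau>)) = 1" by metis
  show thesis
  \<comment> \<open>The product of the periods of the single blocks is a common period.\<close>
  proof (rule that[of "prod m UNIV"])
    show "prod m UNIV > 0" using m(1) by (simp add: prod_pos)
    fix v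
    have "cis (lam i * (real (prod m UNIV) * \<tau>)) = 1" for i
    proof -
      obtain q where "prod m UNIV = m i * q" using dvd_prodI[of UNIV i m] by (auto simp: dvd_def)
      then have "lam i * (real (prod m UNIV) * \<tau>) = real q * (lam i * (real (m i) * \<tau>))" by simp
      then have "cis (lam i * (real (prod m UNIV) * \<tau>)) = cis (lam i * (real (m i) * \<tau>)) ^ q"
        by (simp only: Complex.DeMoivre)
      then show ?thesis by (simp add: m(2))
    qed
    then show "rt (real (prod m UNIV) * \<tau>) v = v" by (simp add: blk_eq_iff blk_R_mat)
  qed
qed

text \<open>An element \<open>(0, 0, \<tau>)\<close> with trivial rotation is central.\<close>

lemma conj_T_fixed:
  assumes "\<And>v. rt \<tau> v = v"
  shows "g \<odot> ((0, 0, \<tau>) \<odot> iv g) = (0, 0, \<tau>)"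
proof -
  obtain z v t where g: "g = (z, v, t)" by (metis prod_cases3)
  have "(0, 0, \<tau>) \<odot> iv g = iv g \<odot> (0, 0, \<tau>)" using assms[of "rt (- t) v"] by (simp add: g)
  then show ?thesis by simp
qed


section \<open>Central elements of a lattice\<close>

text \<open>Elements with t = 0 form a Heisenberg group, where commutators lie in the center and are
  given by \<open>om\<close>; inversion adjusts the sign.\<close>

lemma central_element_of_commutator:
  assumes "(z1, v1, 0) \<in> \<Gamma>" "(z2, v2, 0) \<in> \<Gamma>" "om v1 v2 \<noteq> 0"
  shows "\<exists>T>0. (T, 0, 0) \<in> \<Gamma>"
proof -
  let ?x = "(z1, v1, 0)" and ?y = "(z2, v2, 0)"
  have "iv (?y \<odot> ?x) \<odot> (?x \<odot> ?y) = (om v1 v2, 0, 0)"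
    using om_skew[of v2 v1] by simp
  moreover have "iv (?y \<odot> ?x) \<odot> (?x \<odot> ?y) \<in> \<Gamma>"
    using assms(1,2) by (intro Gamma_mul Gamma_iv)
  ultimately have c: "(om v1 v2, 0, 0) \<in> \<Gamma>" by simp
  then have "(- om v1 v2, 0, 0) \<in> \<Gamma>" using Gamma_iv[OF c] by simp
  with c assms(3) show ?thesis by (metis neg_0_less_iff_less linorder_neqE_linordered_idom)
qed

text \<open>If all blocks are rotated by angles in \<open>(0, \<pi>)\<close>, then \<open>om a (rt t a) > 0\<close> for \<open>a \<noteq> 0\<close>, so an
  element \<open>(z, a, 0)\<close> does not commute with its conjugate. If there is no such element, then all
  commutators have vanishing \<open>v\<close>-part, which bounds the \<open>v\<close>-parts of \<open>\<Gamma>\<close>.\<close>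

lemma central_element_small_rotation:
  assumes \<gamma>: "(z1, v1, t1) \<in> \<Gamma>" and t1: "\<And>i. 0 < lam i * t1" "\<And>i. lam i * t1 < pi"
  shows "\<exists>T>0. (T, 0, 0) \<in> \<Gamma>"
proof (cases "\<exists>z a. (z, a, 0) \<in> \<Gamma> \<and> a \<noteq> 0")
  case True
  then obtain z a where a: "(z, a, 0) \<in> \<Gamma>" "a \<noteq> 0" by blast
  have "(z1, v1, t1) \<odot> ((z, a, 0) \<odot> iv (z1, v1, t1)) \<in> \<Gamma>"
    using \<gamma> a(1) by (intro Gamma_mul Gamma_iv)
  moreover obtain z' where "(z1, v1, t1) \<odot> ((z, a, 0) \<odot> iv (z1, v1, t1)) = (z', rt t1 a, 0)"
    by simp
  ultimately have a': "(z', rt t1 a, 0) \<in> \<Gamma>" by simp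
  have summand: "Im (cnj (blk a i) * blk (rt t1 a) i) = (cmod (blk a i))\<^sup>2 * sin (lam i * t1)" for i
    unfolding cmod_power2 by (simp add: blk_R_mat power2_eq_square algebra_simps)
  have "om a (rt t1 a) = (\<Sum>i\<in>UNIV. (cmod (blk a i))\<^sup>2 * sin (lam i * t1))"
    unfolding om_blk summand ..
  moreover obtain i where "blk a i \<noteq> 0" using a(2) by (auto simp: blk_eq_iff)
  then have "(\<Sum>i\<in>UNIV. (cmod (blk a i))\<^sup>2 * sin (lam i * t1)) > 0"
    using sin_gt_zero[OF t1]
    by (intro sum_pos2[of _ i] mult_pos_pos mult_nonneg_nonneg) (auto simp: less_imp_le)
  ultimately show ?thesis using central_element_of_commutator[OF a(1) a'] by simp
next
  case False
  fix i :: 'n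
  \<comment> \<open>The vanishing \<open>v\<close>-part of the commutator equates
    \<open>(cis (lam i * t1) - 1) * blk v i\<close> with
    \<open>(cis (lam i * t) - 1) * blk v1 i\<close>. Since the factor on the right has modulus at
    most 2, \<open>?C\<close> bounds block \<open>i\<close>, contrary to the choice of
    \<open>\<eta>\<close>.\<close>
  let ?C = "2 * cmod (blk v1 i) / cmod (cis (lam i * t1) - 1)"
  obtain \<eta> z v t where "\<eta> \<in> \<Gamma>" "iv (0, 0, 0) \<odot> (\<eta> \<odot> (0, 0, 0)) = (z, v, t)"
    and large: "?C < cmod (blk v i)" by (rule conj_Gamma_large)
  then have \<eta>: "(z, v, t) \<in> \<Gamma>" by (cases \<eta>) simp
  let ?x = "(z1, v1, t1)" and ?y = "(z, v, t)"
  let ?u = "v1 + rt t1 v - (v + rt t v1)"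
  obtain b where "(?x \<odot> ?y) \<odot> iv (?y \<odot> ?x) = (b, ?u, 0)" by simp
  moreover have "(?x \<odot> ?y) \<odot> iv (?y \<odot> ?x) \<in> \<Gamma>"
    using \<gamma> \<eta> by (intro Gamma_mul Gamma_iv)
  ultimately have "?u = 0" using False by metis
  then have "blk ?u i = 0" by simp
  then have eq: "(cis (lam i * t1) - 1) * blk v i = (cis (lam i * t) - 1) * blk v1 i"
    by (simp add: blk_R_mat algebra_simps)
  have "cmod (cis (lam i * t1) - 1) * cmod (blk v i) = cmod (cis (lam i * t) - 1) * cmod (blk v1 i)"
    unfolding norm_mult[symmetric] eq ..
  also have "\<dots> \<le> 2 * cmod (blk v1 i)"
    using norm_triangle_ineq4[of "cis (lam i * t)" 1] by (intro mult_right_mono) auto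
  finally have "cmod (cis (lam i * t1) - 1) * cmod (blk v i) \<le> 2 * cmod (blk v1 i)" .
  moreover have "cis (lam i * t1) \<noteq> 1"
    using sin_gt_zero[OF t1[of i]] by (auto simp: complex_eq_iff)
  then have "cmod (cis (lam i * t1) - 1) > 0" by simp
  ultimately have "cmod (blk v i) \<le> ?C" by (simp add: field_simps)
  with large show ?thesis by simp
qed

text \<open>Here the \<open>t\<close>-parts of \<open>\<Gamma>\<close> are discrete, so the \<open>v\<close>-parts of the elements with \<open>t = 0\<close> come within
  a bounded distance of every vector, in particular of two long vectors with large \<open>om\<close>.\<close>

lemma central_element_separated:
  assumes \<epsilon>: "\<epsilon> > 0" "\<And>z v t. (z, v, t) \<in> \<Gamma> \<Longrightarrow> \<not> (0 < t \<and> t < \<epsilon>)"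
  shows "\<exists>T>0. (T, 0, 0) \<in> \<Gamma>"
proof -
  obtain K where K: "bounded K" "\<forall>x. \<exists>k\<in>K. \<exists>\<eta>\<in>\<Gamma>. x = k \<odot> \<eta>"
    by (rule bounded_fundamental_set)
  obtain B where B: "\<And>k. k \<in> K \<Longrightarrow> norm k \<le> B" using K(1) unfolding bounded_iff by blast
  define S where "S = (\<lambda>x. snd (snd x)) ` \<Gamma> \<inter> {-B..B}"
  \<comment> \<open>A difference of t-parts is the t-part of a quotient in \<Gamma>, in either
    order.\<close>
  have sep: "s = s'" if s: "(z, v, s) \<in> \<Gamma>" "(z', v', s') \<in> \<Gamma>" "\<bar>s - s'\<bar> < \<epsilon>" for z v s z' v' s'
  proof -
    obtain a b a' b' where ab: "iv (z', v', s') \<odot> (z, v, s) = (a, b, s - s')"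
      "iv (z, v, s) \<odot> (z', v', s') = (a', b', s' - s)" by simp
    have "iv (z', v', s') \<odot> (z, v, s) \<in> \<Gamma>" "iv (z, v, s) \<odot> (z', v', s') \<in> \<Gamma>"
      using s by (auto intro!: Gamma_mul Gamma_iv simp del: mul_osc iv_osc)
    then show ?thesis using \<epsilon>(2) s(3) unfolding ab by (smt (verit))
  qed
  have "inj_on (\<lambda>s. \<lfloor>s / \<epsilon>\<rfloor>) S"
  proof (rule inj_onI)
    fix s s' assume s: "s \<in> S" "s' \<in> S" and fl: "\<lfloor>s / \<epsilon>\<rfloor> = \<lfloor>s' / \<epsilon>\<rfloor>"
    have "\<bar>s / \<epsilon> - s' / \<epsilon>\<bar> < 1" using fl by linarith
    then have "\<bar>s - s'\<bar> < \<epsilon>" using \<epsilon>(1) by (simp add: field_simps abs_less_iff)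
    then show "s = s'" using s sep by (force simp: S_def)
  qed
  moreover have "(\<lambda>s. \<lfloor>s / \<epsilon>\<rfloor>) ` S \<subseteq> {\<lfloor>- B / \<epsilon>\<rfloor>..\<lfloor>B / \<epsilon>\<rfloor>}"
    using \<epsilon>(1) by (auto simp: S_def intro!: floor_mono divide_right_mono) (simp add: field_simps)
  ultimately have "finite S" by (rule inj_on_finite) simp
  have "\<forall>s\<in>S. \<exists>x\<in>\<Gamma>. snd (snd x) = s" by (auto simp: S_def)
  \<comment> \<open>These finitely many lattice elements serve to correct the t-part of an element
    of \<Gamma> to 0 at a bounded cost.\<close>
  then obtain h where h: "\<And>s. s \<in> S \<Longrightarrow> h s \<in> \<Gamma>" "\<And>s. s \<in> S \<Longrightarrow> snd (snd (h s)) = s" by metis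
  have "bounded (\<Union>s\<in>S. (\<lambda>k. (0, 0, 0) \<odot> (k \<odot> h s)) ` K)"
    using \<open>finite S\<close> bounded_translate[OF K(1)] by blast
  then obtain C where C: "\<And>s k. s \<in> S \<Longrightarrow> k \<in> K \<Longrightarrow> norm (k \<odot> h s) \<le> C"
    unfolding bounded_iff by fastforce
  \<comment> \<open>Write \<open>(0, v, 0)\<close> as
    \<open>(k \<odot> h s) \<odot> (iv (h s) \<odot> \<eta>)\<close>: the first factor is bounded
    and the second is a lattice element, both with t = 0.\<close>
  have approx: "\<exists>a w. (a, v - w, 0) \<in> \<Gamma> \<and> norm w \<le> C" for v
  proof -
    obtain k \<eta> where k: "k \<in> K" and \<eta>: "\<eta> \<in> \<Gamma>" and eq: "(0, v, 0) = k \<odot> \<eta>" using K(2) by blast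
    define s where "s = snd (snd \<eta>)"
    have "snd (snd k) + s = 0" using arg_cong[OF eq, of "\<lambda>x. snd (snd x)"]
      by (simp add: mul_components s_def)
    moreover have "\<bar>snd (snd k)\<bar> \<le> B"
      using B[OF k] norm_osc_components_le(2)[of "snd (snd k)" "fst k" "fst (snd k)"] by simp
    ultimately have s: "s \<in> S" using \<eta> by (auto simp: S_def s_def)
    obtain b w t where kh: "k \<odot> h s = (b, w, t)" by (metis prod_cases3)
    have t: "t = 0"
      using arg_cong[OF kh, of "\<lambda>x. snd (snd x)"] h(2)[OF s] \<open>snd (snd k) + s = 0\<close>
      by (simp add: mul_components)
    obtain a x r where \<eta>': "iv (h s) \<odot> \<eta> = (a, x, r)" by (metis prod_cases3)
    have "(0, v, 0) = (k \<odot> h s) \<odot> (iv (h s) \<odot> \<eta>)" by (simp add: eq m_assoc)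
    then have "x = v - w" "r = 0" unfolding kh \<eta>' t by (simp_all add: algebra_simps)
    moreover have "(a, x, r) \<in> \<Gamma>" using Gamma_mul[OF Gamma_iv[OF h(1)[OF s]] \<eta>] by (simp add: \<eta>')
    moreover have "norm w \<le> C"
      using C[OF s k] norm_osc_components_le(1)[of w b t] unfolding kh by linarith
    ultimately show ?thesis by blast
  qed
  obtain M where M: "M > 0" "\<And>v w. \<bar>om v w\<bar> \<le> norm v * norm w * M"
    using bounded_bilinear.pos_bounded[OF bounded_bilinear_om] by (metis real_norm_def)
  have "C \<ge> 0" using approx[of 0] norm_ge_zero order_trans by blast
  \<comment> \<open>With this choice \<open>r * r - 2 * (r * C * M) = r * (C * C * M + 1)\<close>,
    so the main term \<open>om x y\<close> exceeds the three error terms together by at least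
    1.\<close>
  define r where "r = 2 * C * M + C * C * M + 1"
  have r: "r \<ge> 1" using M(1) \<open>C \<ge> 0\<close> by (simp add: r_def)
  fix i :: 'n
  define x y :: "real ^ ('n \<times> 2)" where "x = axis (i, 1) r" and "y = axis (i, 2) r"
  obtain a w a' w' where w: "(a, x - w, 0) \<in> \<Gamma>" "norm w \<le> C" and w': "(a', y - w', 0) \<in> \<Gamma>" "norm w' \<le> C"
    using approx by metis
  have "om x y = (\<Sum>j\<in>UNIV. if j = i then r * r else 0)"
    unfolding om_blk by (intro sum.cong) (auto simp: x_def y_def axis_def)
  then have xy: "om x y = r * r" by simp
  have nr: "norm x = r" "norm y = r" using r by (simp_all add: x_def y_def norm_eq_sqrt_inner inner_axis_axis)
  have "\<bar>om x w'\<bar> \<le> r * C * M" "\<bar>om w y\<bar> \<le> r * C * M" "\<bar>om w w'\<bar> \<le> C * C * M"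
  proof -
    have "norm x * norm w' * M \<le> r * C * M" "norm w * norm y * M \<le> r * C * M"
      "norm w * norm w' * M \<le> C * C * M"
      using w(2) w'(2) M(1) r \<open>C \<ge> 0\<close>
      by (auto simp: nr intro!: mult_mono mult_right_mono mult_left_mono)
    then show "\<bar>om x w'\<bar> \<le> r * C * M" "\<bar>om w y\<bar> \<le> r * C * M" "\<bar>om w w'\<bar> \<le> C * C * M"
      using M(2)[of x w'] M(2)[of w y] M(2)[of w w'] by linarith+
  qed
  moreover have "om (x - w) (y - w') = r * r - om x w' - om w y + om w w'" by (simp add: xy)
  moreover have "r * r - 2 * (r * C * M) \<ge> C * C * M + 1"
  proof -
    have "r * r - 2 * (r * C * M) = r * (C * C * M + 1)" by (simp add: r_def algebra_simps)
    also have "\<dots> \<ge> 1 * (C * C * M + 1)"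
      using r M(1) \<open>C \<ge> 0\<close> by (intro mult_right_mono) auto
    finally show ?thesis by simp
  qed
  ultimately have "om (x - w) (y - w') > 0" unfolding abs_le_iff by linarith
  then show ?thesis using central_element_of_commutator[OF w(1) w'(1)] by simp
qed

text \<open>The threshold \<pi>/L, with L the largest \<lambda>, is chosen so that a smaller
  positive t rotates every block by an angle in (0, \<pi>); without such t in \<Gamma> the t-parts
  are separated.\<close>

lemma central_element:
  obtains T where "T > 0" "(T, 0, 0) \<in> \<Gamma>"
proof -
  define L where "L = Max (range lam)"
  have L: "lam i \<le> L" for i unfolding L_def by (rule Max_ge) auto
  have "L > 0" using L lam_pos less_le_trans by blast
  have "\<exists>T>0. (T, 0, 0) \<in> \<Gamma>"
  proof (cases "\<exists>z v t. (z, v, t) \<in> \<Gamma> \<and> 0 < t \<and> t < pi / L")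
    case True
    then obtain z v t where t: "(z, v, t) \<in> \<Gamma>" "0 < t" "t < pi / L" by blast
    have "lam i * t < pi" for i
    proof -
      have "lam i * t \<le> L * t" using L t(2) by (intro mult_right_mono) auto
      also have "\<dots> < pi" using t(3) \<open>L > 0\<close> by (simp add: field_simps)
      finally show ?thesis .
    qed
    then show ?thesis using t lam_pos by (intro central_element_small_rotation[OF t(1)]) auto
  next
    case False
    then show ?thesis using \<open>L > 0\<close> by (intro central_element_separated[of "pi / L"]) auto
  qed
  with that show thesis by blast
qed


section \<open>Closed geodesics\<close>

lemma vertical_closed: "closed_geodesic UNIV (\<lambda>s. pr (osc_exp (\<alpha>, 0, 0) s \<odot> g))"
proof -
  have ll: "osc_form lam (\<alpha>, 0, 0) (\<alpha>, 0, 0) = 0" by simp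
  have c: "iv g \<odot> ((z, 0, 0) \<odot> g) = (z, 0, 0)" for z
  proof -
    have "(z, 0, 0) \<odot> g = g \<odot> (z, 0, 0)" by (cases g) simp
    then show ?thesis by simp
  qed
  obtain T where T: "T > 0" "(T, 0, 0) \<in> \<Gamma>" by (rule central_element)
  have T': "(- T, 0, 0) \<in> \<Gamma>" using Gamma_iv[OF T(2)] by simp
  have "\<exists>s>0. (s * \<alpha>, 0, 0) \<in> \<Gamma>"
  \<comment> \<open>For \<alpha> = 0 the geodesic is constant and every positive number is a
    period.\<close>
  proof (cases "\<alpha> = 0")
    case True
    then show ?thesis by (intro exI[of _ 1]) simp
  next
    case False
    then have "T / \<bar>\<alpha>\<bar> * \<alpha> \<in> {T, - T}" by (auto simp: abs_if)
    then have "(T / \<bar>\<alpha>\<bar> * \<alpha>, 0, 0) \<in> \<Gamma>" using T(2) T' by auto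
    with False T(1) show ?thesis by (intro exI[of _ "T / \<bar>\<alpha>\<bar>"]) simp
  qed
  then show ?thesis unfolding closed_geodesic_flow_iff[OF ll] by (simp add: c)
qed

text \<open>A multiple of \<open>(0, 0, t0)\<close> rotates trivially and is central, so it equals
  all its conjugates; a transversal flow passes through such a conjugate after a suitable
  time.\<close>

lemma all_closed:
  assumes t0: "t0 \<noteq> 0" "(0, 0, t0) \<in> \<Gamma>" and A: "osc_form lam A A = 0"
  shows "closed_geodesic UNIV (\<lambda>s. pr (osc_exp A s \<odot> g))"
  using A
proof (cases rule: lightlike_cases)
  case (vertical \<alpha>)
  then show ?thesis using vertical_closed by blast
next
  case (transversal \<beta> h)
  have 1: "(0, 0, 0) \<odot> ((0, 0, t0) \<odot> iv (0, 0, 0)) \<in> \<Gamma>" using t0(2) by simp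
  obtain m where m: "m > 0" "\<And>v. rt (real m * t0) v = v"
    using conj_T_finite_order[OF 1] by blast
  define u where "u = real m * t0"
  have u: "(0, 0, u) \<in> \<Gamma>" using conj_T_multiple[OF 1, of m] by (simp add: u_def)
  have u': "(0, 0, - u) \<in> \<Gamma>" using Gamma_iv[OF u] by simp
  have rt: "rt u v = v" "rt (- u) v = v" for v
    using m(2)[of v] m(2)[of "rt (- u) v"] by (simp_all add: u_def)
  \<comment> \<open>Up to sign \<beta>T is \<open>u\<close>, and \<Gamma> contains the elements for
    both signs.\<close>
  define T where "T = \<bar>u\<bar> / \<bar>\<beta>\<bar>"
  have "T > 0" using t0(1) m(1) transversal(1) by (simp add: T_def u_def)
  have "\<beta> * T \<in> {u, - u}" using transversal(1) by (auto simp: T_def abs_if)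
  then have bT: "(0, 0, \<beta> * T) \<in> \<Gamma>" "\<And>v. rt (\<beta> * T) v = v" using u u' rt by auto
  have "iv g \<odot> (osc_exp A T \<odot> g)
      = (iv g \<odot> (0, h, 0)) \<odot> ((0, 0, \<beta> * T) \<odot> iv (iv g \<odot> (0, h, 0)))"
    unfolding transversal(3) by (simp add: m_assoc inv_mult_group del: mul_osc)
  then have "iv g \<odot> (osc_exp A T \<odot> g) \<in> \<Gamma>" using conj_T_fixed[OF bT(2)] bT(1) by simp
  with \<open>T > 0\<close> show ?thesis unfolding closed_geodesic_flow_iff[OF A] by blast
qed

text \<open>A period puts a conjugate of \<open>(0, 0, \<beta> * T)\<close> into \<Gamma>. Some
  power of it is central, hence of the excluded form itself.\<close>

lemma transversal_not_closed:
  assumes t0: "\<And>t. t \<noteq> 0 \<Longrightarrow> (0, 0, t) \<notin> \<Gamma>"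
    and A: "osc_form lam A A = 0" "snd (snd A) \<noteq> 0"
  shows "\<not> closed_geodesic UNIV (\<lambda>s. pr (osc_exp A s \<odot> g))"
  using A(1)
proof (cases rule: lightlike_cases)
  case (transversal \<beta> h)
  have "iv g \<odot> (osc_exp A T \<odot> g) \<notin> \<Gamma>" if "T > 0" for T
  proof
    let ?g = "iv g \<odot> (0, h, 0)"
    assume "iv g \<odot> (osc_exp A T \<odot> g) \<in> \<Gamma>"
    moreover have "iv g \<odot> (osc_exp A T \<odot> g) = ?g \<odot> ((0, 0, \<beta> * T) \<odot> iv ?g)"
      unfolding transversal(3) by (simp add: m_assoc inv_mult_group del: mul_osc)
    ultimately have 1: "?g \<odot> ((0, 0, \<beta> * T) \<odot> iv ?g) \<in> \<Gamma>" by simp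
    obtain m where m: "m > 0" "\<And>v. rt (real m * (\<beta> * T)) v = v"
      using conj_T_finite_order[OF 1] by blast
    have "(0, 0, real m * (\<beta> * T)) \<in> \<Gamma>"
      using conj_T_multiple[OF 1, of m] conj_T_fixed[OF m(2), of ?g] by simp
    moreover have "real m * (\<beta> * T) \<noteq> 0" using m(1) that transversal(1) by simp
    ultimately show False using t0 by blast
  qed
  then show ?thesis unfolding closed_geodesic_flow_iff[OF A(1)] by blast
qed (use A(2) in simp)

lemma unique_closed_direction:
  assumes t0: "\<And>t. t \<noteq> 0 \<Longrightarrow> (0, 0, t) \<notin> \<Gamma>" and p: "p \<in> osc_quot lam \<Gamma>"
  shows "(\<exists>!D. lightlike_direction lam \<Gamma> p D \<and>
      (\<forall>I c. lightlike_geodesic_in_direction lam \<Gamma> p D I c \<longrightarrow> closed_geodesic I c)) \<and>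
    lightlike_direction lam \<Gamma> p (Z_direction lam \<Gamma> p) \<and>
    (\<forall>I c. lightlike_geodesic_in_direction lam \<Gamma> p (Z_direction lam \<Gamma> p) I c
      \<longrightarrow> closed_geodesic I c) \<and>
    (\<forall>D. lightlike_direction lam \<Gamma> p D \<and> D \<noteq> Z_direction lam \<Gamma> p \<longrightarrow>
      (\<forall>I c. lightlike_geodesic_in_direction lam \<Gamma> p D I c \<longrightarrow> \<not> closed_geodesic I c))"
proof -
  define good where "good D \<longleftrightarrow>
    (\<forall>I c. lightlike_geodesic_in_direction lam \<Gamma> p D I c \<longrightarrow> closed_geodesic I c)" for D
  have Z: "(osc_Z :: 'n osc) \<noteq> 0" "osc_form lam osc_Z osc_Z = 0"
    by (simp_all add: osc_Z_def zero_prod_def)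
  have dirZ: "lightlike_direction lam \<Gamma> p (Z_direction lam \<Gamma> p)"
    unfolding lightlike_direction_iff[OF p] Z_direction_eq[OF p] using Z by blast
  have closedZ: "good (Z_direction lam \<Gamma> p)"
    unfolding good_def Z_direction_eq[OF p] lightlike_geodesic_in_direction_iff[OF p Z]
    using vertical_closed by (auto simp: osc_Z_def)
  have dir: "\<exists>A. A \<noteq> 0 \<and> osc_form lam A A = 0 \<and> snd (snd A) \<noteq> 0 \<and> D = tv p ` span {A}"
    if D: "lightlike_direction lam \<Gamma> p D" "D \<noteq> Z_direction lam \<Gamma> p" for D
  proof -
    obtain A where A: "A \<noteq> 0" "osc_form lam A A = 0" "D = tv p ` span {A}"
      using D(1) unfolding lightlike_direction_iff[OF p] by blast
    have "snd (snd A) \<noteq> 0"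
      using A(2)
    proof (cases rule: lightlike_cases)
      case (vertical \<alpha>)
      then have "A = \<alpha> *\<^sub>R osc_Z" "\<alpha> \<noteq> 0" using A(1) by (auto simp: osc_Z_def zero_prod_def)
      then have "osc_Z = (1 / \<alpha>) *\<^sub>R A" by simp
      with \<open>A = \<alpha> *\<^sub>R osc_Z\<close> have "A \<in> span {osc_Z}" "osc_Z \<in> span {A}"
        using span_scale[OF span_base[of osc_Z "{osc_Z}"], of \<alpha>] span_scale[OF span_base[of A "{A}"], of "1 / \<alpha>"]
        by auto
      then have "span {A} = span {osc_Z}" by (simp add: span_eq)
      then show ?thesis using D(2) A(3) Z_direction_eq[OF p] by simp
    qed simp
    with A show ?thesis by blast
  qed
  have notclosed: "\<not> closed_geodesic I c"
    if D: "lightlike_direction lam \<Gamma> p D" "D \<noteq> Z_direction lam \<Gamma> p"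
      and geo: "lightlike_geodesic_in_direction lam \<Gamma> p D I c" for D I c
  proof -
    obtain A where A: "A \<noteq> 0" "osc_form lam A A = 0" "snd (snd A) \<noteq> 0" "D = tv p ` span {A}"
      using dir[OF D] by blast
    obtain r g where "I = UNIV" "r \<noteq> 0" "c = (\<lambda>s. pr (osc_exp (r *\<^sub>R A) s \<odot> g))"
      using geo unfolding A(4) lightlike_geodesic_in_direction_iff[OF p A(1,2)] by blast
    then show ?thesis
      using transversal_not_closed[OF t0, of "r *\<^sub>R A" g] A by (simp add: osc_form_scaleR)
  qed
  have "D = Z_direction lam \<Gamma> p" if D: "lightlike_direction lam \<Gamma> p D" "good D" for D
  proof (rule ccontr)
    assume neq: "D \<noteq> Z_direction lam \<Gamma> p"
    obtain A where A: "A \<noteq> 0" "osc_form lam A A = 0" "D = tv p ` span {A}"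
      using dir[OF D(1) neq] by blast
    \<comment> \<open>A direction without geodesics would satisfy the closedness condition
      vacuously; the flow curve of \<open>A\<close> through \<open>p\<close> rules this out.\<close>
    obtain g where "pr g = p" using p osc_quot_pr by auto
    then have "lightlike_geodesic_in_direction lam \<Gamma> p D UNIV (\<lambda>s. pr (osc_exp A s \<odot> g))"
      unfolding A(3) lightlike_geodesic_in_direction_iff[OF p A(1,2)]
      by (intro conjI refl exI[of _ 1] exI[of _ g]) auto
    then show False using notclosed[OF D(1) neq] D(2) unfolding good_def by blast
  qed
  with dirZ closedZ have "\<exists>!D. lightlike_direction lam \<Gamma> p D \<and> good D" by blast
  with dirZ closedZ show ?thesis
    unfolding good_def[symmetric] by (intro conjI) (use notclosed in blast)+
qed

end

theorem theorem3p4: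
  fixes lam :: "'n::finite \<Rightarrow> real" and \<Gamma> :: "'n osc set"
  assumes "\<forall>i. lam i > 0" and "cocompact_lattice lam \<Gamma>"
  shows
    "((\<exists>t0. t0 \<noteq> 0 \<and> (0, 0, t0) \<in> \<Gamma>) \<and>
      (\<forall>I c. lightlike_geodesic lam \<Gamma> I c \<longrightarrow> closed_geodesic I c))
     \<noteq>
     ((\<forall>t. t \<noteq> 0 \<longrightarrow> (0, 0, t) \<notin> \<Gamma>) \<and>
      (\<forall>p\<in>osc_quot lam \<Gamma>.
         (\<exists>!D. lightlike_direction lam \<Gamma> p D \<and>
            (\<forall>I c. lightlike_geodesic_in_direction lam \<Gamma> p D I c \<longrightarrow> closed_geodesic I c)) \<and>
         lightlike_direction lam \<Gamma> p (Z_direction lam \<Gamma> p) \<and>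
         (\<forall>I c. lightlike_geodesic_in_direction lam \<Gamma> p (Z_direction lam \<Gamma> p) I c
            \<longrightarrow> closed_geodesic I c) \<and>
         (\<forall>D. lightlike_direction lam \<Gamma> p D \<and> D \<noteq> Z_direction lam \<Gamma> p \<longrightarrow>
            (\<forall>I c. lightlike_geodesic_in_direction lam \<Gamma> p D I c \<longrightarrow> \<not> closed_geodesic I c))))"
proof -
  interpret osc_lattice lam \<Gamma>
    using assms by (intro osc_lattice.intro osc_discrete.intro oscillator.intro
        osc_discrete_axioms.intro osc_lattice_axioms.intro) (simp_all add: cocompact_lattice_def)
  show ?thesis
  \<comment> \<open>The first conjuncts of the two alternatives negate each other. In each case one
    alternative is refuted by its first conjunct and the other one has to be proved.\<close>
  proof (cases "\<exists>t0. t0 \<noteq> 0 \<and> (0, 0, t0) \<in> \<Gamma>")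
    case True
    then obtain t0 where t0: "t0 \<noteq> 0" "(0, 0, t0) \<in> \<Gamma>" by blast
    have "closed_geodesic I c" if ll: "lightlike_geodesic lam \<Gamma> I c" for I c
    proof -
      from ll obtain A g where "I = UNIV" "osc_form lam A A = 0" "c = (\<lambda>s. pr (osc_exp A s \<odot> g))"
        by (rule lightlike_geodesic_imp_flow)
      then show ?thesis using all_closed[OF t0] by simp
    qed
    with t0 show ?thesis by blast
  next
    case False
    then have t0: "(0, 0, t) \<notin> \<Gamma>" if "t \<noteq> 0" for t using that by blast
    have neq: "X \<noteq> Y" if "\<not> X" "Y" for X Y using that by blast
    show ?thesis
    proof (rule neq)
      show "\<not> ((\<exists>t0. t0 \<noteq> 0 \<and> (0, 0, t0) \<in> \<Gamma>) \<and>
        (\<forall>I c. lightlike_geodesic lam \<Gamma> I c \<longrightarrow> closed_geodesic I c))"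
        using False by blast
    qed (intro conjI[OF _ ballI] unique_closed_direction[OF t0] allI impI t0)
  qed
qed

end
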